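(* Let $(M,\phi,\xi,\eta,g)$ be a $(2n+1)$-dimensional Kenmotsu manifold, let $a>0$ be a constant, and let $(\overline{\phi},\overline{\xi},\overline{\eta},\overline{g})$ be the $D$-homothetically deformed structure on $M$. Let $f\in C^\infty(M)$. If $(V=\overline{\mathrm{grad}}(f),\overline{\lambda})$ defines a gradient almost Riemann soliton in $(M,\overline{g})$, then $$\begin{aligned}|\mathrm{Ric}|_{g}^2\geq{}& (2n-1)^2|\mathrm{Hess}(f)|_{g}^2-4n\frac{a-1}{a}\mathrm{scal}-4n^2(2n+1)\left(\frac{a-1}{a}\right)^2\\ &-\frac{(2n-1)^2}{2n+1}(\Delta(f))^2-\frac{2(2n-1)^2}{2n+1}\frac{a-1}{a}[\xi(f)-\xi(\xi(f))]\Delta(f)\\ &+\frac{2n(2n-1)^2}{2n+1}\left(\frac{a-1}{a}\right)^2(\xi(f))^2-\frac{2(2n-1)^2(n+na+a)(a-1)}{(2n+1)a^2}(\xi(\xi(f)))^2\\ &+\frac{2(2n-1)^2(2n+a)(a-1)}{(2n+1)a^2}\xi(f)\cdot\xi(\xi(f)).\end{aligned}$$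
   Context: An almost contact metric manifold $(M,\phi,\xi,\eta,g)$ is an odd-dimensional Riemannian manifold $(M,g)$, here of dimension $2n+1$ with $n\ge 1$, together with a $(1,1)$-tensor field $\phi$, a vector field $\xi$ (the Reeb vector field) and a $1$-form $\eta$ such that $\phi^2=-I+\eta\otimes\xi$, $\eta(\xi)=1$, $\eta=g(\xi,\cdot)$ and $g(\phi X,\phi Y)=g(X,Y)-\eta(X)\eta(Y)$. It is a Kenmotsu manifold if the Levi-Civita connection $\nabla$ of $g$ satisfies $(\nabla_X\phi)Y=g(\phi X,Y)\xi-\eta(Y)\phi X$ for all vector fields $X,Y$. For a constant $a>0$, the $D$-homothetically deformed structure is $\overline{\phi}=\phi$, $\overline{\xi}=\frac{1}{a}\xi$, $\overline{\eta}=a\eta$, $\overline{g}=ag+a(a-1)\eta\otimes\eta$. For a Riemannian metric $h$, a nowhere-vanishing vector field $V$ and a smooth function $\lambda$ on $M$, the pair $(V,\lambda)$ defines an almost Riemann soliton in $(M,h)$ if $\frac12\mathcal{L}_Vh\odot h+R_h=\frac{\lambda}{2}\,h\odot h$; it is called gradient if $V$ is the $h$-gradient of a smooth function. Here $\mathcal{L}$ is the Lie derivative; $R_h(X,Y,Z,W)=h(R_h(X,Y)Z,W)$ with $R_h(X,Y)Z=\nabla^h_X\nabla^h_YZ-\nabla^h_Y\nabla^h_XZ-\nabla^h_{[X,Y]}Z$; and for $(0,2)$-tensors $(T_1\odot T_2)(X,Y,Z,W)=T_1(X,W)T_2(Y,Z)+T_1(Y,Z)T_2(X,W)-T_1(X,Z)T_2(Y,W)-T_1(Y,W)T_2(X,Z)$.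 $\mathrm{Hess},\Delta,\mathrm{Ric},\mathrm{scal}$ are the Hessian, Laplace operator (trace of the Hessian), Ricci tensor and scalar curvature of $g$; $\overline{\mathrm{grad}}$ is the gradient with respect to $\overline{g}$. $|T|_{g}$ is the Hilbert–Schmidt norm: $|T|_{g}^2=\sum_{i,j}T(e_i,e_j)^2$ for a $g$-orthonormal frame $(e_i)$. The inequality is pointwise on $M$. *)

theory Defs
  imports "HOL-Analysis.Analysis"
begin

section \<open>Smooth manifolds\<close>

text \<open>Only meaningful for open \<open>S\<close>: derivatives are taken in the ambient space.\<close>

primrec Ck_on :: "nat \<Rightarrow> 'a::real_normed_vector set \<Rightarrow> ('a \<Rightarrow> 'b::real_normed_vector) \<Rightarrow> bool" where
  "Ck_on 0 S f \<longleftrightarrow> continuous_on S f"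
| "Ck_on (Suc k) S f \<longleftrightarrow>
     (\<forall>x\<in>S. f differentiable (at x)) \<and> (\<forall>v. Ck_on k S (\<lambda>x. frechet_derivative f (at x) v))"

definition smooth_on :: "'a::real_normed_vector set \<Rightarrow> ('a \<Rightarrow> 'b::real_normed_vector) \<Rightarrow> bool" where
  "smooth_on S f \<longleftrightarrow> (\<forall>k. Ck_on k S f)"

text \<open>
  The underlying space of the manifold is a whole type \<open>'p\<close> (Hausdorff and second countable), the
  model space is \<open>'e\<close>, so the dimension is \<open>DIM('e)\<close>.  The atlas need not be maximal.
\<close>

type_synonym ('p, 'e) atlas = "('p set \<times> ('p \<Rightarrow> 'e)) set"

definition smooth_atlas ::
  "('p::{t2_space,second_countable_topology}, 'e::euclidean_space) atlas \<Rightarrow> bool" where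
  "smooth_atlas A \<longleftrightarrow>
     (\<Union>(U, \<psi>)\<in>A. U) = UNIV \<and>
     (\<forall>(U, \<psi>)\<in>A. open U \<and> open (\<psi> ` U) \<and> homeomorphism U (\<psi> ` U) \<psi> (inv_into U \<psi>)) \<and>
     (\<forall>(U, \<psi>)\<in>A. \<forall>(V, \<psi>')\<in>A. smooth_on (\<psi> ` (U \<inter> V)) (\<psi>' \<circ> inv_into U \<psi>))"

definition smooth_fun :: "('p, 'e::euclidean_space) atlas \<Rightarrow> ('p \<Rightarrow> real) \<Rightarrow> bool" where
  "smooth_fun A f \<longleftrightarrow> (\<forall>(U, \<psi>)\<in>A. smooth_on (\<psi> ` U) (f \<circ> inv_into U \<psi>))"

section \<open>Tangent vectors and vector fields\<close>

text \<open>
  A tangent vector at \<open>p\<close> is a derivation at \<open>p\<close> of the algebra of smooth functions.  Since HOL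
  functions are total, it is set to \<open>0\<close> on non-smooth functions; in this way distinct elements of
  the tangent space are distinct derivations.
\<close>

type_synonym 'p tvec = "('p \<Rightarrow> real) \<Rightarrow> real"
type_synonym 'p vfield = "'p \<Rightarrow> 'p tvec"
type_synonym 'p oneform = "'p \<Rightarrow> 'p tvec \<Rightarrow> real"
type_synonym 'p endo = "'p \<Rightarrow> 'p tvec \<Rightarrow> 'p tvec"
type_synonym 'p metric = "'p \<Rightarrow> 'p tvec \<Rightarrow> 'p tvec \<Rightarrow> real"

definition tv_zero :: "'p tvec" where "tv_zero = (\<lambda>f. 0)"
definition tv_add :: "'p tvec \<Rightarrow> 'p tvec \<Rightarrow> 'p tvec" where "tv_add u v = (\<lambda>f. u f + v f)"
definition tv_diff :: "'p tvec \<Rightarrow> 'p tvec \<Rightarrow> 'p tvec" where "tv_diff u v = (\<lambda>f. u f - v f)"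
definition tv_scale :: "real \<Rightarrow> 'p tvec \<Rightarrow> 'p tvec" where "tv_scale c v = (\<lambda>f. c * v f)"

definition tangent_space :: "('p, 'e::euclidean_space) atlas \<Rightarrow> 'p \<Rightarrow> 'p tvec set" where
  "tangent_space A p =
     {v. (\<forall>f h. smooth_fun A f \<longrightarrow> smooth_fun A h \<longrightarrow>
              v (\<lambda>q. f q + h q) = v f + v h \<and>
              v (\<lambda>q. f q * h q) = f p * v h + h p * v f) \<and>
         (\<forall>c f. smooth_fun A f \<longrightarrow> v (\<lambda>q. c * f q) = c * v f) \<and>
         (\<forall>f. \<not> smooth_fun A f \<longrightarrow> v f = 0)}"

text \<open>\<open>deriv_along X f\<close> is the function \<open>X(f)\<close>.\<close>

definition deriv_along :: "'p vfield \<Rightarrow> ('p \<Rightarrow> real) \<Rightarrow> 'p \<Rightarrow> real" where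
  "deriv_along X f = (\<lambda>p. X p f)"

definition vector_field :: "('p, 'e::euclidean_space) atlas \<Rightarrow> 'p vfield \<Rightarrow> bool" where
  "vector_field A X \<longleftrightarrow>
     (\<forall>p. X p \<in> tangent_space A p) \<and>
     (\<forall>f. smooth_fun A f \<longrightarrow> smooth_fun A (deriv_along X f))"

definition vf_add :: "'p vfield \<Rightarrow> 'p vfield \<Rightarrow> 'p vfield" where
  "vf_add X Y = (\<lambda>p. tv_add (X p) (Y p))"
definition vf_diff :: "'p vfield \<Rightarrow> 'p vfield \<Rightarrow> 'p vfield" where
  "vf_diff X Y = (\<lambda>p. tv_diff (X p) (Y p))"
definition vf_scale :: "('p \<Rightarrow> real) \<Rightarrow> 'p vfield \<Rightarrow> 'p vfield" where
  "vf_scale h X = (\<lambda>p. tv_scale (h p) (X p))"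

definition bracket :: "'p vfield \<Rightarrow> 'p vfield \<Rightarrow> 'p vfield" where
  "bracket X Y = (\<lambda>p f. X p (deriv_along Y f) - Y p (deriv_along X f))"

section \<open>Riemannian metrics and the Levi-Civita connection\<close>

definition riemannian_metric :: "('p, 'e::euclidean_space) atlas \<Rightarrow> 'p metric \<Rightarrow> bool" where
  "riemannian_metric A g \<longleftrightarrow>
     (\<forall>p. \<forall>u\<in>tangent_space A p. \<forall>v\<in>tangent_space A p.
        g p u v = g p v u \<and>
        (u \<noteq> tv_zero \<longrightarrow> g p u u > 0) \<and>
        (\<forall>w\<in>tangent_space A p. g p (tv_add u v) w = g p u w + g p v w) \<and>
        (\<forall>c. g p (tv_scale c u) v = c * g p u v)) \<and>
     (\<forall>X Y. vector_field A X \<longrightarrow> vector_field A Y \<longrightarrow> smooth_fun A (\<lambda>p. g p (X p) (Y p)))"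

text \<open>Tensor fields obtained by differentiation are represented by their values on vector fields.\<close>

type_synonym 'p tensor2 = "'p vfield \<Rightarrow> 'p vfield \<Rightarrow> 'p \<Rightarrow> real"
type_synonym 'p tensor4 = "'p vfield \<Rightarrow> 'p vfield \<Rightarrow> 'p vfield \<Rightarrow> 'p vfield \<Rightarrow> 'p \<Rightarrow> real"
type_synonym 'p connection = "'p vfield \<Rightarrow> 'p vfield \<Rightarrow> 'p vfield"

definition on_fields :: "'p metric \<Rightarrow> 'p tensor2" where
  "on_fields g X Y = (\<lambda>p. g p (X p) (Y p))"

definition affine_connection :: "('p, 'e::euclidean_space) atlas \<Rightarrow> 'p connection \<Rightarrow> bool" where
  "affine_connection A D \<longleftrightarrow>
     (\<forall>X Y. vector_field A X \<longrightarrow> vector_field A Y \<longrightarrow> vector_field A (D X Y)) \<and>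
     (\<forall>X Y Z. vector_field A X \<longrightarrow> vector_field A Y \<longrightarrow> vector_field A Z \<longrightarrow>
        D (vf_add X Y) Z = vf_add (D X Z) (D Y Z) \<and>
        D Z (vf_add X Y) = vf_add (D Z X) (D Z Y)) \<and>
     (\<forall>h X Y. smooth_fun A h \<longrightarrow> vector_field A X \<longrightarrow> vector_field A Y \<longrightarrow>
        D (vf_scale h X) Y = vf_scale h (D X Y) \<and>
        D X (vf_scale h Y) = vf_add (vf_scale (deriv_along X h) Y) (vf_scale h (D X Y)))"

definition is_levi_civita ::
  "('p, 'e::euclidean_space) atlas \<Rightarrow> 'p metric \<Rightarrow> 'p connection \<Rightarrow> bool" where
  "is_levi_civita A g D \<longleftrightarrow>
     affine_connection A D \<and>
     (\<forall>X Y. vector_field A X \<longrightarrow> vector_field A Y \<longrightarrow> vf_diff (D X Y) (D Y X) = bracket X Y) \<and>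
     (\<forall>X Y Z. vector_field A X \<longrightarrow> vector_field A Y \<longrightarrow> vector_field A Z \<longrightarrow>
        deriv_along X (on_fields g Y Z) =
          (\<lambda>p. on_fields g (D X Y) Z p + on_fields g Y (D X Z) p))"

text \<open>
  The Levi-Civita connection is unique on vector fields, which are the only arguments at which it
  is ever evaluated; its (irrelevant) values elsewhere are why this is not a \<open>THE\<close>.
\<close>

definition levi_civita :: "('p, 'e::euclidean_space) atlas \<Rightarrow> 'p metric \<Rightarrow> 'p connection" where
  "levi_civita A g = (SOME D. is_levi_civita A g D)"

definition gradient :: "('p, 'e::euclidean_space) atlas \<Rightarrow> 'p metric \<Rightarrow> ('p \<Rightarrow> real) \<Rightarrow> 'p vfield" where
  "gradient A g f =
     (\<lambda>p. THE v. v \<in> tangent_space A p \<and> (\<forall>u\<in>tangent_space A p. g p v u = u f))"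

definition hessian ::
  "('p, 'e::euclidean_space) atlas \<Rightarrow> 'p metric \<Rightarrow> ('p \<Rightarrow> real) \<Rightarrow> 'p tensor2" where
  "hessian A g f X Y =
     (\<lambda>p. deriv_along X (deriv_along Y f) p - deriv_along (levi_civita A g X Y) f p)"

definition lie_deriv_metric :: "'p vfield \<Rightarrow> 'p metric \<Rightarrow> 'p tensor2" where
  "lie_deriv_metric V h X Y =
     (\<lambda>p. deriv_along V (on_fields h X Y) p
          - on_fields h (bracket V X) Y p - on_fields h X (bracket V Y) p)"

section \<open>Curvature\<close>

definition curvature ::
  "('p, 'e::euclidean_space) atlas \<Rightarrow> 'p metric \<Rightarrow> 'p vfield \<Rightarrow> 'p vfield \<Rightarrow> 'p vfield \<Rightarrow> 'p vfield" where
  "curvature A g X Y Z =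
     (let D = levi_civita A g
      in vf_diff (vf_diff (D X (D Y Z)) (D Y (D X Z))) (D (bracket X Y) Z))"

definition riemann :: "('p, 'e::euclidean_space) atlas \<Rightarrow> 'p metric \<Rightarrow> 'p tensor4" where
  "riemann A g X Y Z W = on_fields g (curvature A g X Y Z) W"

text \<open>
  Orthonormal frames at a point \<open>p\<close> are given by global vector fields whose values at \<open>p\<close> form a
  \<open>g\<close>-orthonormal basis of the tangent space at \<open>p\<close>; they need not be orthonormal elsewhere.  Traces
  and norms of tensors at \<open>p\<close> do not depend on the frame chosen.
\<close>

definition orthonormal_at ::
  "('p, 'e::euclidean_space) atlas \<Rightarrow> 'p metric \<Rightarrow> 'p \<Rightarrow> (nat \<Rightarrow> 'p vfield) \<Rightarrow> bool" where
  "orthonormal_at A g p E \<longleftrightarrow>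
     (\<forall>i<DIM('e). vector_field A (E i)) \<and>
     (\<forall>i<DIM('e). \<forall>j<DIM('e). g p (E i p) (E j p) = (if i = j then 1 else 0))"

definition frame_at ::
  "('p, 'e::euclidean_space) atlas \<Rightarrow> 'p metric \<Rightarrow> 'p \<Rightarrow> nat \<Rightarrow> 'p vfield" where
  "frame_at A g p = (SOME E. orthonormal_at A g p E)"

definition metric_trace ::
  "('p, 'e::euclidean_space) atlas \<Rightarrow> 'p metric \<Rightarrow> 'p tensor2 \<Rightarrow> 'p \<Rightarrow> real" where
  "metric_trace A g T p = (\<Sum>i<DIM('e). T (frame_at A g p i) (frame_at A g p i) p)"

definition hs_norm ::
  "('p, 'e::euclidean_space) atlas \<Rightarrow> 'p metric \<Rightarrow> 'p tensor2 \<Rightarrow> 'p \<Rightarrow> real" where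
  "hs_norm A g T p =
     sqrt (\<Sum>i<DIM('e). \<Sum>j<DIM('e). (T (frame_at A g p i) (frame_at A g p j) p)\<^sup>2)"

definition laplacian ::
  "('p, 'e::euclidean_space) atlas \<Rightarrow> 'p metric \<Rightarrow> ('p \<Rightarrow> real) \<Rightarrow> 'p \<Rightarrow> real" where
  "laplacian A g f = metric_trace A g (hessian A g f)"

text \<open>\<open>Ric(Y,Z)\<close> is the trace of the endomorphism \<open>X \<mapsto> R(X,Y)Z\<close>.\<close>

definition ricci :: "('p, 'e::euclidean_space) atlas \<Rightarrow> 'p metric \<Rightarrow> 'p tensor2" where
  "ricci A g Y Z = metric_trace A g (\<lambda>X W. riemann A g X Y Z W)"

definition scalar_curv :: "('p, 'e::euclidean_space) atlas \<Rightarrow> 'p metric \<Rightarrow> 'p \<Rightarrow> real" where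
  "scalar_curv A g = metric_trace A g (ricci A g)"

section \<open>Almost contact metric and Kenmotsu manifolds\<close>

definition one_form :: "('p, 'e::euclidean_space) atlas \<Rightarrow> 'p oneform \<Rightarrow> bool" where
  "one_form A \<eta> \<longleftrightarrow>
     (\<forall>p. \<forall>u\<in>tangent_space A p.
        (\<forall>v\<in>tangent_space A p. \<eta> p (tv_add u v) = \<eta> p u + \<eta> p v) \<and>
        (\<forall>c. \<eta> p (tv_scale c u) = c * \<eta> p u)) \<and>
     (\<forall>X. vector_field A X \<longrightarrow> smooth_fun A (\<lambda>p. \<eta> p (X p)))"

definition apply_endo :: "'p endo \<Rightarrow> 'p vfield \<Rightarrow> 'p vfield" where
  "apply_endo \<phi> X = (\<lambda>p. \<phi> p (X p))"

definition tensor_field_11 :: "('p, 'e::euclidean_space) atlas \<Rightarrow> 'p endo \<Rightarrow> bool" where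
  "tensor_field_11 A \<phi> \<longleftrightarrow>
     (\<forall>p. \<forall>u\<in>tangent_space A p.
        \<phi> p u \<in> tangent_space A p \<and>
        (\<forall>v\<in>tangent_space A p. \<phi> p (tv_add u v) = tv_add (\<phi> p u) (\<phi> p v)) \<and>
        (\<forall>c. \<phi> p (tv_scale c u) = tv_scale c (\<phi> p u))) \<and>
     (\<forall>X. vector_field A X \<longrightarrow> vector_field A (apply_endo \<phi> X))"

definition almost_contact_metric ::
  "('p::{t2_space,second_countable_topology}, 'e::euclidean_space) atlas \<Rightarrow>
   'p endo \<Rightarrow> 'p vfield \<Rightarrow> 'p oneform \<Rightarrow> 'p metric \<Rightarrow> bool" where
  "almost_contact_metric A \<phi> \<xi> \<eta> g \<longleftrightarrow>
     smooth_atlas A \<and> odd DIM('e) \<and>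
     riemannian_metric A g \<and> tensor_field_11 A \<phi> \<and> vector_field A \<xi> \<and> one_form A \<eta> \<and>
     (\<forall>p. \<eta> p (\<xi> p) = 1) \<and>
     (\<forall>p. \<forall>u\<in>tangent_space A p.
        \<phi> p (\<phi> p u) = tv_add (tv_scale (-1) u) (tv_scale (\<eta> p u) (\<xi> p)) \<and>
        \<eta> p u = g p (\<xi> p) u \<and>
        (\<forall>v\<in>tangent_space A p. g p (\<phi> p u) (\<phi> p v) = g p u v - \<eta> p u * \<eta> p v))"

text \<open>
  ``The Levi-Civita connection satisfies ...'' is rendered as a definite description: there is a
  Levi-Civita connection (it always exists and is unique on vector fields) and it satisfies ...;
  the left-hand side of the equation is \<open>(\<nabla>\<^sub>X \<phi>) Y = \<nabla>\<^sub>X (\<phi> Y) - \<phi> (\<nabla>\<^sub>X Y)\<close>.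
\<close>

definition kenmotsu ::
  "('p::{t2_space,second_countable_topology}, 'e::euclidean_space) atlas \<Rightarrow>
   'p endo \<Rightarrow> 'p vfield \<Rightarrow> 'p oneform \<Rightarrow> 'p metric \<Rightarrow> bool" where
  "kenmotsu A \<phi> \<xi> \<eta> g \<longleftrightarrow>
     almost_contact_metric A \<phi> \<xi> \<eta> g \<and>
     (\<exists>D. is_levi_civita A g D \<and>
        (\<forall>X Y. vector_field A X \<longrightarrow> vector_field A Y \<longrightarrow>
           vf_diff (D X (apply_endo \<phi> Y)) (apply_endo \<phi> (D X Y)) =
           vf_diff (vf_scale (on_fields g (apply_endo \<phi> X) Y) \<xi>)
                   (vf_scale (\<lambda>p. \<eta> p (Y p)) (apply_endo \<phi> X))))"

definition D_homothetic ::
  "real \<Rightarrow> 'p endo \<Rightarrow> 'p vfield \<Rightarrow> 'p oneform \<Rightarrow> 'p metric \<Rightarrow>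
   'p endo \<times> 'p vfield \<times> 'p oneform \<times> 'p metric" where
  "D_homothetic a \<phi> \<xi> \<eta> g =
     (\<phi>,
      vf_scale (\<lambda>p. 1 / a) \<xi>,
      \<lambda>p u. a * \<eta> p u,
      \<lambda>p u v. a * g p u v + a * (a - 1) * (\<eta> p u * \<eta> p v))"

section \<open>Almost Riemann solitons\<close>

definition kulkarni_nomizu :: "'p tensor2 \<Rightarrow> 'p tensor2 \<Rightarrow> 'p tensor4" where
  "kulkarni_nomizu S T X Y Z W =
     (\<lambda>p. S X W p * T Y Z p + S Y Z p * T X W p - S X Z p * T Y W p - S Y W p * T X Z p)"

definition almost_riemann_soliton ::
  "('p, 'e::euclidean_space) atlas \<Rightarrow> 'p metric \<Rightarrow> 'p vfield \<Rightarrow> ('p \<Rightarrow> real) \<Rightarrow> bool" where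
  "almost_riemann_soliton A h V lam \<longleftrightarrow>
     vector_field A V \<and> (\<forall>p. V p \<noteq> tv_zero) \<and> smooth_fun A lam \<and>
     (\<forall>X Y Z W p. vector_field A X \<longrightarrow> vector_field A Y \<longrightarrow> vector_field A Z \<longrightarrow> vector_field A W \<longrightarrow>
        1 / 2 * kulkarni_nomizu (lie_deriv_metric V h) (on_fields h) X Y Z W p + riemann A h X Y Z W p
        = lam p / 2 * kulkarni_nomizu (on_fields h) (on_fields h) X Y Z W p)"

end

theory Submission
  imports Defs
begin

text \<open>
  Write \<open>b = (a - 1) / a\<close>, \<open>m = 2n - 1\<close>, \<open>N = 2n + 1\<close>, \<open>P = g - \<eta> \<otimes> \<eta>\<close>, \<open>h = \<xi>(f)\<close>,
  \<open>k = \<xi>(\<xi>(f))\<close>.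

  On a Kenmotsu manifold \<open>\<nabla>\<^sub>X \<xi> = X - \<eta>(X) \<xi>\<close> (\<open>nabla_xi\<close>).  It follows that the deformed metric has the
  Levi-Civita connection \<open>\<nabla>\<^sub>X Y + b P(X,Y) \<xi>\<close> (\<open>Db_levi_civita\<close>) and the curvature
  \<open>R(X,Y)Z + b (P(Y,Z) X - P(X,Z) Y)\<close> (\<open>curvature_deformed\<close>), while half of the Lie derivative of the
  deformed metric along the gradient is the deformed Hessian \<open>Hess(f) - b h P\<close>.  Contracting the
  soliton equation with the inverse of the deformed metric (\<open>ricci_trace\<close>) therefore gives, for some number
  \<open>\<mu>\<close> at the given point,
  \<open>Ric + 2nb P = \<mu> (a g + a (a - 1) \<eta> \<otimes> \<eta>) - m (Hess(f) - b h P)\<close>.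
  Since \<open>Ric(\<xi>,\<xi>) = -2n\<close> and \<open>Hess(f)(\<xi>,\<xi>) = k\<close>, the component along \<open>\<xi>\<close> yields
  \<open>\<mu> a\<^sup>2 = m k - 2n\<close>: the soliton function has disappeared, and \<open>Ric\<close> is \<open>- m Hess(f)\<close> plus an explicit
  combination of \<open>g\<close> and \<open>\<eta> \<otimes> \<eta>\<close>.  Taking norms and traces, the difference of the two sides of the
  claimed inequality turns out to be the square \<open>(scal + 2nNb)\<^sup>2 / N\<close> (\<open>ricci_norm_inequality\<close>).

  The norms and traces are taken in a \<open>g\<close>-orthonormal frame of global fields, so one needs such
  frames at every point, and that they span all derivations.  Both follow from a bump function and
  Hadamard's lemma, which identify the derivations at a point with the model space
  (\<open>tangent_coordinates\<close>).  To expand a tensor in such a frame one also needs that it depends only on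
  the values of the fields at the point.  For the Hessian this holds because, with respect to the
  deformed metric, it is the inner product of \<open>\<nabla>\<^sub>X V\<close> with \<open>Y\<close>, which sees only the value of
  \<open>Y\<close>, and because it is symmetric; the curvature inherits it through the soliton equation.
\<close>

section \<open>Smooth functions on open subsets of a normed space\<close>

lemma Ck_on_subset: "Ck_on k S f \<Longrightarrow> T \<subseteq> S \<Longrightarrow> Ck_on k T f"
  by (induction k arbitrary: f) (auto intro: continuous_on_subset)

lemma Ck_on_cong:
  assumes "open S" "\<And>x. x \<in> S \<Longrightarrow> f x = g x" "Ck_on k S f"
  shows "Ck_on k S g"
  using assms(2,3)
proof (induction k arbitrary: f g)
  case 0
  then show ?case by (simp cong: continuous_on_cong)
next
  case (Suc k)
  have d: "g differentiable (at x)" "frechet_derivative f (at x) = frechet_derivative g (at x)"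
    if "x \<in> S" for x
  proof -
    have *: "(f has_derivative frechet_derivative f (at x)) (at x)"
      using Suc.prems(2) that by (auto simp: frechet_derivative_works)
    have **: "(g has_derivative frechet_derivative f (at x)) (at x)"
      by (rule has_derivative_transform_within_open[OF * assms(1) that]) (use Suc.prems in auto)
    then show "g differentiable (at x)" by (auto simp: differentiable_def)
    show "frechet_derivative f (at x) = frechet_derivative g (at x)"
      using frechet_derivative_at[OF **] .
  qed
  show ?case
    using Suc.prems(2) d Suc.IH[of "\<lambda>x. frechet_derivative f (at x) _" "\<lambda>x. frechet_derivative g (at x) _"]
    by auto
qed

lemma Ck_on_local:
  assumes "\<And>x. x \<in> S \<Longrightarrow> \<exists>T. open T \<and> x \<in> T \<and> Ck_on k T f"
  shows "Ck_on k S f"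
  using assms
proof (induction k arbitrary: f)
  case 0
  have "isCont f x" if "x \<in> S" for x
    using 0[OF that] continuous_on_eq_continuous_at by auto
  then show ?case by (simp add: continuous_at_imp_continuous_on)
next
  case (Suc k)
  have "Ck_on k S (\<lambda>x. frechet_derivative f (at x) v)" for v
    using Suc.prems by (intro Suc.IH) (metis Ck_on.simps(2))
  moreover have "f differentiable (at x)" if "x \<in> S" for x
    using Suc.prems[OF that] by auto
  ultimately show ?case by simp
qed

lemma Ck_on_SucD: "Ck_on (Suc k) S f \<Longrightarrow> Ck_on k S f"
proof (induction k arbitrary: f)
  case 0
  then show ?case
    by (auto intro!: continuous_at_imp_continuous_on differentiable_imp_continuous_within)
qed simp

text \<open>The derivative may be given by any family \<open>f'\<close> of linear maps; only its values on \<open>S\<close> matter, which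
  is where openness of \<open>S\<close> enters.\<close>

lemma Ck_on_SucI:
  assumes "\<And>x. x \<in> S \<Longrightarrow> (f has_derivative f' x) (at x)"
    and "\<And>v. Ck_on k S (\<lambda>x. f' x v)" and "open S"
  shows "Ck_on (Suc k) S f"
proof -
  have "frechet_derivative f (at x) = f' x" if "x \<in> S" for x
    using frechet_derivative_at[OF assms(1)[OF that]] by simp
  then show ?thesis
    using assms by (auto simp: differentiable_def intro: Ck_on_cong[OF assms(3)])
qed

lemma Ck_on_differentiable: "Ck_on (Suc k) S f \<Longrightarrow> x \<in> S \<Longrightarrow>
    (f has_derivative frechet_derivative f (at x)) (at x)"
  by (simp add: frechet_derivative_works[symmetric])

lemma Ck_on_const: "open S \<Longrightarrow> Ck_on k S (\<lambda>x. c)"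
  by (induction k arbitrary: c) auto

lemma Ck_on_add:
  assumes "open S" "Ck_on k S f" "Ck_on k S g"
  shows "Ck_on k S (\<lambda>x. f x + g x)"
  using assms(2,3)
proof (induction k arbitrary: f g)
  case (Suc k)
  show ?case
    by (rule Ck_on_SucI[OF has_derivative_add[OF Ck_on_differentiable[OF Suc.prems(1)]
            Ck_on_differentiable[OF Suc.prems(2)]]])
      (use Suc assms(1) in auto)
qed (simp, intro continuous_intros)

lemma Ck_on_sum:
  assumes "open S" "\<And>i. i \<in> I \<Longrightarrow> Ck_on k S (f i)"
  shows "Ck_on k S (\<lambda>x. \<Sum>i\<in>I. f i x)"
  using assms(2)
  by (induction I rule: infinite_finite_induct) (auto intro!: Ck_on_const Ck_on_add assms(1))

lemma Ck_on_bounded_linear: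
  assumes "open S" "bounded_linear L" "Ck_on k S f"
  shows "Ck_on k S (\<lambda>x. L (f x))"
  using assms(3)
proof (induction k arbitrary: f)
  case 0
  then show ?case using assms(2) by (auto intro: bounded_linear.continuous_on)
next
  case (Suc k)
  show ?case
    by (rule Ck_on_SucI[OF bounded_linear.has_derivative[OF assms(2) Ck_on_differentiable[OF Suc.prems]]])
      (use Suc assms(1) in auto)
qed

lemma Ck_on_mult:
  fixes f g :: "_ \<Rightarrow> real"
  assumes "open S" "Ck_on k S f" "Ck_on k S g"
  shows "Ck_on k S (\<lambda>x. f x * g x)"
  using assms(2,3)
proof (induction k arbitrary: f g)
  case (Suc k)
  show ?case
    by (rule Ck_on_SucI[OF has_derivative_mult[OF Ck_on_differentiable[OF Suc.prems(1)]
            Ck_on_differentiable[OF Suc.prems(2)]]])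
      (use Suc.prems assms(1) in \<open>auto intro!: Ck_on_add Suc.IH Ck_on_SucD[OF Suc.prems(1)] Ck_on_SucD[OF Suc.prems(2)]\<close>)
qed (simp, intro continuous_intros)

lemma Ck_on_linear: "open S \<Longrightarrow> bounded_linear L \<Longrightarrow> Ck_on k S L"
proof (induction k)
  case 0
  then show ?case by (auto intro: linear_continuous_on)
next
  case (Suc k)
  show ?case
    by (rule Ck_on_SucI[OF bounded_linear_imp_has_derivative[OF Suc.prems(2)]])
      (use Suc.prems in \<open>auto intro: Ck_on_const\<close>)
qed

text \<open>The derivative of \<open>f \<circ> h\<close> in direction \<open>v\<close> is the sum over the standard basis of the partial
  derivatives of \<open>f\<close>, evaluated along \<open>h\<close>, times the components of the derivative of \<open>h\<close>; each
  summand is of class \<open>C\<^sup>k\<close> by the induction hypothesis applied to the partial derivatives.\<close>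

lemma Ck_on_compose:
  fixes f :: "'b::euclidean_space \<Rightarrow> real" and h :: "'a::real_normed_vector \<Rightarrow> 'b"
  assumes "open S" "open T" "h ` S \<subseteq> T" "Ck_on k S h" "Ck_on k T f"
  shows "Ck_on k S (\<lambda>x. f (h x))"
  using assms(4,5)
proof (induction k arbitrary: f)
  case 0
  then show ?case using assms(3) by (auto intro: continuous_on_compose2)
next
  case (Suc k)
  have d: "((\<lambda>x. f (h x)) has_derivative
      (\<lambda>v. \<Sum>b\<in>Basis. (frechet_derivative h (at x) v \<bullet> b) * frechet_derivative f (at (h x)) b)) (at x)"
    if "x \<in> S" for x
  proof -
    have hx: "h x \<in> T" using that assms(3) by auto
    have f': "(f has_derivative frechet_derivative f (at (h x))) (at (h x))"
      by (rule Ck_on_differentiable[OF Suc.prems(2) hx])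
    have "frechet_derivative f (at (h x)) w =
        (\<Sum>b\<in>Basis. (w \<bullet> b) * frechet_derivative f (at (h x)) b)" for w
    proof -
      interpret bounded_linear "frechet_derivative f (at (h x))"
        by (rule has_derivative_bounded_linear[OF f'])
      have "frechet_derivative f (at (h x)) (\<Sum>b\<in>Basis. (w \<bullet> b) *\<^sub>R b) =
          (\<Sum>b\<in>Basis. (w \<bullet> b) * frechet_derivative f (at (h x)) b)"
        by (simp add: sum scaleR)
      then show ?thesis by (simp add: euclidean_representation)
    qed
    then show ?thesis
      by (intro has_derivative_eq_rhs[OF has_derivative_compose[OF Ck_on_differentiable[OF Suc.prems(1) that] f']] ext)
  qed
  show ?case
  proof (rule Ck_on_SucI[OF d])
    fix v
    have "Ck_on k S (\<lambda>x. frechet_derivative f (at (h x)) b)" for b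
      using Suc.IH[OF Ck_on_SucD[OF Suc.prems(1)], of "\<lambda>x. frechet_derivative f (at x) b"] Suc.prems(2)
      by auto
    moreover have "Ck_on k S (\<lambda>x. frechet_derivative h (at x) v \<bullet> b)" for b
      using Suc.prems(1) by (auto intro: Ck_on_bounded_linear[OF assms(1) bounded_linear_inner_left])
    ultimately show "Ck_on k S (\<lambda>x. \<Sum>b\<in>Basis. (frechet_derivative h (at x) v \<bullet> b) *
        frechet_derivative f (at (h x)) b)"
      by (intro Ck_on_sum Ck_on_mult assms(1))
  qed (use assms(1) in auto)
qed

lemma smooth_on_differentiable:
  "smooth_on S f \<Longrightarrow> x \<in> S \<Longrightarrow> (f has_derivative frechet_derivative f (at x)) (at x)"
  using Ck_on_differentiable[of 0 S f x] unfolding smooth_on_def by blast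

lemma smooth_on_frechet: "smooth_on S f \<Longrightarrow> smooth_on S (\<lambda>x. frechet_derivative f (at x) v)"
  unfolding smooth_on_def by (metis Ck_on.simps(2))

lemma smooth_on_compose:
  fixes f :: "'b::euclidean_space \<Rightarrow> real"
  shows "open S \<Longrightarrow> open T \<Longrightarrow> h ` S \<subseteq> T \<Longrightarrow> smooth_on S h \<Longrightarrow> smooth_on T f \<Longrightarrow>
    smooth_on S (\<lambda>x. f (h x))"
  unfolding smooth_on_def using Ck_on_compose by metis

lemma smooth_on_mult: "open S \<Longrightarrow> smooth_on S f \<Longrightarrow> smooth_on S g \<Longrightarrow> smooth_on S (\<lambda>x. f x * g x :: real)"
  unfolding smooth_on_def using Ck_on_mult by metis

lemma smooth_on_add: "open S \<Longrightarrow> smooth_on S f \<Longrightarrow> smooth_on S g \<Longrightarrow> smooth_on S (\<lambda>x. f x + g x)"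
  unfolding smooth_on_def using Ck_on_add by metis

lemma smooth_on_sum:
  "open S \<Longrightarrow> (\<And>i. i \<in> I \<Longrightarrow> smooth_on S (f i)) \<Longrightarrow> smooth_on S (\<lambda>x. \<Sum>i\<in>I. f i x)"
  unfolding smooth_on_def by (simp add: Ck_on_sum)

lemma smooth_on_const: "open S \<Longrightarrow> smooth_on S (\<lambda>x. c)"
  unfolding smooth_on_def using Ck_on_const by metis

lemma smooth_on_linear: "open S \<Longrightarrow> bounded_linear L \<Longrightarrow> smooth_on S L"
  unfolding smooth_on_def using Ck_on_linear by metis

lemma smooth_on_subset: "smooth_on S f \<Longrightarrow> T \<subseteq> S \<Longrightarrow> smooth_on T f"
  unfolding smooth_on_def using Ck_on_subset by metis

lemma smooth_on_cong: "open S \<Longrightarrow> (\<And>x. x \<in> S \<Longrightarrow> f x = g x) \<Longrightarrow> smooth_on S f \<Longrightarrow> smooth_on S g"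
  unfolding smooth_on_def using Ck_on_cong by metis

lemma smooth_on_local:
  "(\<And>x. x \<in> S \<Longrightarrow> \<exists>T. open T \<and> x \<in> T \<and> smooth_on T f) \<Longrightarrow> smooth_on S f"
  unfolding smooth_on_def using Ck_on_local by metis

section \<open>A bump function\<close>

text \<open>The functions \<open>s\<^sup>-\<^sup>j exp (-1/s)\<close>, extended by zero to \<open>s \<le> 0\<close>, are closed under
  differentiation up to linear combinations, so each of them is smooth.\<close>

definition flat_fun :: "nat \<Rightarrow> real \<Rightarrow> real" where
  "flat_fun j s = (if s > 0 then exp (- 1 / s) / s ^ j else 0)"

lemma flat_fun_tendsto_0: "(flat_fun j \<longlongrightarrow> 0) (at_right 0)"
proof -
  have "((\<lambda>x::real. x ^ j / exp x) \<longlongrightarrow> 0) at_top"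
    by (rule tendsto_power_div_exp_0)
  then have "((\<lambda>s::real. inverse s ^ j / exp (inverse s)) \<longlongrightarrow> 0) (at_right 0)"
    by (rule filterlim_compose[OF _ filterlim_inverse_at_top_right])
  moreover have "eventually (\<lambda>s::real. inverse s ^ j / exp (inverse s) = flat_fun j s) (at_right 0)"
    by (auto simp: eventually_at_right_field flat_fun_def exp_minus field_simps intro!: exI[of _ 1])
  ultimately show ?thesis by (rule Lim_transform_eventually)
qed

lemma flat_fun_deriv:
  "(flat_fun j has_real_derivative flat_fun (j + 2) s - real j * flat_fun (j + 1) s) (at s)"
proof -
  consider "s < 0" | "s = 0" | "s > 0" by linarith
  then show ?thesis
  proof cases
    case 1
    then have "((\<lambda>x. 0) has_real_derivative flat_fun (j + 2) s - real j * flat_fun (j + 1) s) (at s)"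
      by (simp add: flat_fun_def)
    then show ?thesis
      by (rule has_field_derivative_transform_within_open[of _ _ _ "{..<0}"])
        (use 1 in \<open>auto simp: flat_fun_def\<close>)
  next
    case 2
    have "((\<lambda>y. (flat_fun j y - flat_fun j 0) / (y - 0)) \<longlongrightarrow> 0) (at 0)"
    proof (rule filterlim_split_at)
      show "((\<lambda>y. (flat_fun j y - flat_fun j 0) / (y - 0)) \<longlongrightarrow> 0) (at_left 0)"
        by (rule tendsto_eventually) (auto simp: eventually_at_left_field flat_fun_def intro!: exI[of _ "-1"])
      have "eventually (\<lambda>y. flat_fun (j + 1) y = (flat_fun j y - flat_fun j 0) / (y - 0)) (at_right 0)"
        by (auto simp: eventually_at_right_field flat_fun_def intro!: exI[of _ 1])
      then show "((\<lambda>y. (flat_fun j y - flat_fun j 0) / (y - 0)) \<longlongrightarrow> 0) (at_right 0)"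
        by (rule Lim_transform_eventually[OF flat_fun_tendsto_0])
    qed
    then show ?thesis unfolding 2 has_field_derivative_iff by (simp add: flat_fun_def)
  next
    case 3
    have "((\<lambda>x. exp (- 1 / x) / x ^ j) has_real_derivative
        flat_fun (j + 2) s - real j * flat_fun (j + 1) s) (at s)"
      using 3
      by (cases j)
        (auto intro!: derivative_eq_intros simp: flat_fun_def divide_simps power2_eq_square algebra_simps,
         metis One_nat_def power_eq_if)
    then show ?thesis
      by (rule has_field_derivative_transform_within_open[of _ _ _ "{0<..}"])
        (use 3 in \<open>auto simp: flat_fun_def\<close>)
  qed
qed

lemma smooth_flat_fun: "smooth_on UNIV (flat_fun j)"
proof -
  have "Ck_on k UNIV (flat_fun j)" for k
  proof (induction k arbitrary: j)
    case 0
    have "continuous_on UNIV (flat_fun j)"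
      by (intro continuous_at_imp_continuous_on ballI DERIV_isCont[OF flat_fun_deriv])
    then show ?case by simp
  next
    case (Suc k)
    show ?case
    proof (rule Ck_on_SucI)
      fix s :: real
      show "(flat_fun j has_derivative (\<lambda>v. (flat_fun (j + 2) s + (- real j) * flat_fun (j + 1) s) * v)) (at s)"
        using flat_fun_deriv[of j s] unfolding has_field_derivative_def by simp
      show "Ck_on k UNIV (\<lambda>s. (flat_fun (j + 2) s + (- real j) * flat_fun (j + 1) s) * v)" for v
        by (intro Ck_on_mult Ck_on_add Ck_on_const Suc.IH) auto
    qed auto
  qed
  then show ?thesis by (simp add: smooth_on_def)
qed

text \<open>The argument \<open>r\<^sup>2 - \<bar>x - x0\<bar>\<^sup>2\<close> is smooth even at \<open>x0\<close>, unlike \<open>\<bar>x - x0\<bar>\<close>; the constant factor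
  makes the value at the centre equal to one.\<close>

definition bump :: "'e::euclidean_space \<Rightarrow> real \<Rightarrow> 'e \<Rightarrow> real" where
  "bump x0 r x = exp (1 / r\<^sup>2) * flat_fun 0 (r\<^sup>2 - (norm (x - x0))\<^sup>2)"

lemma bump_center: "r > 0 \<Longrightarrow> bump x0 r x0 = 1"
  by (simp add: bump_def flat_fun_def exp_minus field_simps)

lemma bump_outside: "r > 0 \<Longrightarrow> x \<notin> cball x0 r \<Longrightarrow> bump x0 r x = 0"
proof -
  assume "r > 0" "x \<notin> cball x0 r"
  then have "r\<^sup>2 \<le> (norm (x - x0))\<^sup>2"
    by (intro power_mono) (auto simp: dist_norm norm_minus_commute)
  then show ?thesis by (simp add: bump_def flat_fun_def)
qed

lemma smooth_bump: "smooth_on UNIV (bump x0 r)"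
proof -
  have *: "smooth_on UNIV (\<lambda>x::'a. (x - x0) \<bullet> b)" for b
    using smooth_on_add[OF open_UNIV smooth_on_linear[OF open_UNIV bounded_linear_inner_left]
        smooth_on_const[OF open_UNIV], of b "- (x0 \<bullet> b)"]
    by (simp add: inner_diff_left)
  have "smooth_on UNIV (\<lambda>x. \<Sum>b\<in>Basis. ((x - x0) \<bullet> b) * ((x - x0) \<bullet> b))"
    by (intro smooth_on_sum smooth_on_mult * open_UNIV)
  then have "smooth_on UNIV (\<lambda>x. r\<^sup>2 + (-1) * (\<Sum>b\<in>Basis. ((x - x0) \<bullet> b) * ((x - x0) \<bullet> b)))"
    by (intro smooth_on_add smooth_on_const smooth_on_mult) auto
  moreover have "r\<^sup>2 + (-1) * (\<Sum>b\<in>Basis. ((x - x0) \<bullet> b) * ((x - x0) \<bullet> b)) = r\<^sup>2 - (norm (x - x0))\<^sup>2" for x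
    unfolding power2_norm_eq_inner by (subst (3) euclidean_inner) simp
  ultimately have "smooth_on UNIV (\<lambda>x. r\<^sup>2 - (norm (x - x0))\<^sup>2)" by simp
  then show ?thesis
    unfolding bump_def
    by (intro smooth_on_mult smooth_on_const smooth_on_compose[OF _ _ _ _ smooth_flat_fun]) auto
qed

section \<open>Hadamard's lemma\<close>

text \<open>Differentiating under the integral sign replaces \<open>F\<close> by a directional derivative and raises
  the exponent by one; the exponent is carried along only to make the induction on the
  differentiability class go through.\<close>

lemma smooth_on_segment_integral:
  fixes F :: "'e::euclidean_space \<Rightarrow> real"
  assumes F: "smooth_on (ball x0 R) F"
  shows "smooth_on (ball x0 R) (\<lambda>x. integral {0..1} (\<lambda>t. t ^ j * F (x0 + t *\<^sub>R (x - x0))))"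
proof -
  let ?B = "ball x0 R"
  have inB: "x0 + t *\<^sub>R (x - x0) \<in> ?B" if "x \<in> ?B" "t \<in> {0..1}" for x t
  proof -
    have "norm (t *\<^sub>R (x - x0)) \<le> 1 * norm (x - x0)"
      unfolding norm_scaleR using that by (intro mult_right_mono) auto
    then show ?thesis using that by (auto simp: dist_norm norm_minus_commute)
  qed
  have deriv: "((\<lambda>x. integral {0..1} (\<lambda>t. t ^ j * F (x0 + t *\<^sub>R (x - x0)))) has_derivative
      (\<lambda>v. integral {0..1} (\<lambda>t. t ^ Suc j * frechet_derivative F (at (x0 + t *\<^sub>R (x - x0))) v))) (at x)"
    if F: "smooth_on ?B F" and x: "x \<in> ?B" for F j x
  proof -
    define fx where "fx x t = Blinfun (\<lambda>v. t ^ Suc j * frechet_derivative F (at (x0 + t *\<^sub>R (x - x0))) v)" for x t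
    have bl: "bounded_linear (\<lambda>v. t ^ Suc j * frechet_derivative F (at (x0 + t *\<^sub>R (x - x0))) v)"
      if "x \<in> ?B" "t \<in> {0..1}" for x t
      by (intro bounded_linear_const_mult
          has_derivative_bounded_linear[OF smooth_on_differentiable[OF F inB[OF that]]])
    have fx: "blinfun_apply (fx x t) v = t ^ Suc j * frechet_derivative F (at (x0 + t *\<^sub>R (x - x0))) v"
      if "x \<in> ?B" "t \<in> {0..1}" for x t v
      unfolding fx_def using bounded_linear_Blinfun_apply[OF bl[OF that]] by simp
    have cont: "continuous_on ?B G" if "smooth_on ?B G" for G :: "'e \<Rightarrow> real"
      using that unfolding smooth_on_def by (metis Ck_on.simps(1))
    have seg: "continuous_on (?B \<times> {0..1}) (\<lambda>z. x0 + snd z *\<^sub>R (fst z - x0))"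
      by (intro continuous_intros)
    have contfx: "continuous_on (?B \<times> cbox 0 1) (\<lambda>(x, t). fx x t)"
    proof (rule continuous_on_blinfun_componentwise)
      fix i :: 'e
      have "continuous_on (?B \<times> {0..1}) (\<lambda>z. snd z ^ Suc j *
          frechet_derivative F (at (x0 + snd z *\<^sub>R (fst z - x0))) i)"
        by (intro continuous_intros continuous_on_compose2[OF cont[OF smooth_on_frechet[OF F]] seg])
          (use inB in auto)
      then show "continuous_on (?B \<times> cbox 0 1) (\<lambda>z. blinfun_apply (case z of (x, t) \<Rightarrow> fx x t) i)"
        by (rule iffD1[OF continuous_on_cong, rotated 2]) (auto simp: fx)
    qed
    have intg: "(\<lambda>t. t ^ j * F (x0 + t *\<^sub>R (y - x0))) integrable_on cbox 0 1" if "y \<in> ?B" for y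
      by (rule integrable_continuous, intro continuous_intros continuous_on_compose2[OF cont[OF F]])
        (use inB[OF that] in auto)
    have A: "((\<lambda>x. integral (cbox 0 1) (\<lambda>t. t ^ j * F (x0 + t *\<^sub>R (x - x0)))) has_derivative
        integral (cbox 0 1) (fx x)) (at x within ?B)"
    proof (rule leibniz_rule[OF _ intg contfx x])
      fix y :: 'e and t :: real assume y: "y \<in> ?B" and t: "t \<in> cbox 0 1"
      have t': "t \<in> {0..1}" using t by simp
      have "((\<lambda>y. t ^ j * F (x0 + t *\<^sub>R (y - x0))) has_derivative
          (\<lambda>v. t ^ j * frechet_derivative F (at (x0 + t *\<^sub>R (y - x0))) (t *\<^sub>R v))) (at y)"
      proof -
        have "((\<lambda>y. x0 + t *\<^sub>R (y - x0)) has_derivative (\<lambda>v. t *\<^sub>R v)) (at y)"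
          by (auto intro!: derivative_eq_intros)
        from has_derivative_compose[OF this smooth_on_differentiable[OF F inB[OF y t']]]
        show ?thesis by (intro has_derivative_mult_right)
      qed
      moreover have "t ^ j * frechet_derivative F (at (x0 + t *\<^sub>R (y - x0))) (t *\<^sub>R v) = blinfun_apply (fx y t) v" for v
        using fx[OF y t'] linear_cmul[OF has_derivative_linear[OF smooth_on_differentiable[OF F inB[OF y t']]]]
        by simp
      ultimately show "((\<lambda>y. t ^ j * F (x0 + t *\<^sub>R (y - x0))) has_derivative blinfun_apply (fx y t)) (at y within ?B)"
        by (auto intro: has_derivative_at_withinI)
    qed auto
    have "blinfun_apply (integral (cbox 0 1) (fx x)) v =
        integral {0..1} (\<lambda>t. t ^ Suc j * frechet_derivative F (at (x0 + t *\<^sub>R (x - x0))) v)" for v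
    proof -
      have "continuous_on (cbox 0 1) (\<lambda>t. (\<lambda>(x, t). fx x t) (x, t))"
        by (rule continuous_on_compose2[OF contfx]) (use x in \<open>auto intro: continuous_intros\<close>)
      then have "fx x integrable_on cbox 0 1" by (intro integrable_continuous) simp
      then have "blinfun_apply (integral (cbox 0 1) (fx x)) v = integral (cbox 0 1) (\<lambda>t. blinfun_apply (fx x t) v)"
        by (rule blinfun_apply_integral)
      also have "\<dots> = integral (cbox 0 1) (\<lambda>t. t ^ Suc j * frechet_derivative F (at (x0 + t *\<^sub>R (x - x0))) v)"
        by (intro integral_cong) (use fx[OF x] in auto)
      finally show ?thesis by simp
    qed
    then have eq: "blinfun_apply (integral (cbox 0 1) (fx x)) =
        (\<lambda>v. integral {0..1} (\<lambda>t. t ^ Suc j * frechet_derivative F (at (x0 + t *\<^sub>R (x - x0))) v))"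
      by blast
    show ?thesis
      using A[unfolded at_within_open[OF x open_ball] eq] by (simp only: cbox_interval)
  qed
  have "Ck_on k ?B (\<lambda>x. integral {0..1} (\<lambda>t. t ^ j * F (x0 + t *\<^sub>R (x - x0))))"
    if "smooth_on ?B F" for k F j
    using that
  proof (induction k arbitrary: F j)
    case 0
    show ?case
      by simp (intro continuous_at_imp_continuous_on ballI has_derivative_continuous[OF deriv[OF 0]])
  next
    case (Suc k)
    show ?case
      by (rule Ck_on_SucI[OF deriv[OF Suc.prems]])
        (assumption | rule open_ball Suc.IH[OF smooth_on_frechet[OF Suc.prems]])+
  qed
  then show ?thesis using F by (simp add: smooth_on_def)
qed

text \<open>The function \<open>G b\<close> is the mean of the partial derivative \<open>\<partial>\<^sub>b F\<close> over the segment from \<open>x0\<close> to \<open>x\<close>;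
  the formula is the fundamental theorem of calculus along this segment.\<close>

lemma hadamard:
  fixes F :: "'e::euclidean_space \<Rightarrow> real"
  assumes F: "smooth_on (ball x0 R) F" and R: "R > 0"
  obtains G where "\<And>b. smooth_on (ball x0 R) (G b)"
    and "\<And>x. x \<in> ball x0 R \<Longrightarrow> F x = F x0 + (\<Sum>b\<in>Basis. ((x - x0) \<bullet> b) * G b x)"
    and "\<And>b. G b x0 = frechet_derivative F (at x0) b"
proof -
  define G where "G b x = integral {0..1} (\<lambda>t. t ^ 0 * frechet_derivative F (at (x0 + t *\<^sub>R (x - x0))) b)" for b x
  have "smooth_on (ball x0 R) (G b)" for b
    unfolding G_def by (intro smooth_on_segment_integral smooth_on_frechet F)
  moreover have "F x = F x0 + (\<Sum>b\<in>Basis. ((x - x0) \<bullet> b) * G b x)" if x: "x \<in> ball x0 R" for x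
  proof -
    have inB: "x0 + t *\<^sub>R (x - x0) \<in> ball x0 R" if "t \<in> {0..1}" for t
    proof -
      have "norm (t *\<^sub>R (x - x0)) \<le> 1 * norm (x - x0)"
        unfolding norm_scaleR using that by (intro mult_right_mono) auto
      then show ?thesis using x by (auto simp: dist_norm norm_minus_commute)
    qed
    let ?F' = "\<lambda>t. frechet_derivative F (at (x0 + t *\<^sub>R (x - x0)))"
    have lin: "?F' t (x - x0) = (\<Sum>b\<in>Basis. ((x - x0) \<bullet> b) * ?F' t b)" if "t \<in> {0..1}" for t
    proof -
      interpret linear "?F' t"
        by (rule has_derivative_linear[OF smooth_on_differentiable[OF F inB[OF that]]])
      have "?F' t (\<Sum>b\<in>Basis. ((x - x0) \<bullet> b) *\<^sub>R b) = (\<Sum>b\<in>Basis. ((x - x0) \<bullet> b) * ?F' t b)"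
        by (simp add: sum scale)
      then show ?thesis by (simp add: euclidean_representation)
    qed
    have "((\<lambda>t. ?F' t (x - x0)) has_integral F (x0 + 1 *\<^sub>R (x - x0)) - F (x0 + 0 *\<^sub>R (x - x0))) {0..1}"
    proof (rule fundamental_theorem_of_calculus)
      fix t :: real assume t: "t \<in> {0..1}"
      have "((\<lambda>t. F (x0 + t *\<^sub>R (x - x0))) has_derivative (\<lambda>s. ?F' t (s *\<^sub>R (x - x0)))) (at t)"
      proof -
        have "((\<lambda>t. x0 + t *\<^sub>R (x - x0)) has_derivative (\<lambda>s. s *\<^sub>R (x - x0))) (at t)"
          by (auto intro!: derivative_eq_intros)
        from has_derivative_compose[OF this smooth_on_differentiable[OF F inB[OF t]]]
        show ?thesis .
      qed
      then show "((\<lambda>t. F (x0 + t *\<^sub>R (x - x0))) has_vector_derivative ?F' t (x - x0)) (at t within {0..1})"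
        unfolding has_vector_derivative_def
        using linear_cmul[OF has_derivative_linear[OF smooth_on_differentiable[OF F inB[OF t]]]]
        by (auto intro: has_derivative_at_withinI)
    qed simp
    then have "F x - F x0 = integral {0..1} (\<lambda>t. ?F' t (x - x0))"
      by (simp add: integral_unique)
    also have "\<dots> = integral {0..1} (\<lambda>t. \<Sum>b\<in>Basis. ((x - x0) \<bullet> b) * ?F' t b)"
      by (intro integral_cong lin)
    also have "\<dots> = (\<Sum>b\<in>Basis. ((x - x0) \<bullet> b) * G b x)"
    proof (subst integral_sum)
      fix b :: 'e
      have "continuous_on (ball x0 R) (\<lambda>x. frechet_derivative F (at x) b)"
        using smooth_on_frechet[OF F] unfolding smooth_on_def by (metis Ck_on.simps(1))
      then have "continuous_on {0..1} (\<lambda>t. ?F' t b)"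
        by (rule continuous_on_compose2) (use inB in \<open>auto intro!: continuous_intros\<close>)
      then show "(\<lambda>t. ((x - x0) \<bullet> b) * ?F' t b) integrable_on {0..1}"
        by (intro integrable_continuous_interval continuous_intros)
    qed (auto simp: G_def)
    finally show ?thesis by simp
  qed
  moreover have "G b x0 = frechet_derivative F (at x0) b" for b
    by (simp add: G_def)
  ultimately show ?thesis using that by blast
qed

section \<open>Smooth functions and tangent vectors on a manifold\<close>

lemma smooth_atlasD:
  assumes "smooth_atlas A" "(U, \<psi>) \<in> A"
  shows "open U" "open (\<psi> ` U)" "homeomorphism U (\<psi> ` U) \<psi> (inv_into U \<psi>)"
    and "\<And>V \<kappa>. (V, \<kappa>) \<in> A \<Longrightarrow> smooth_on (\<psi> ` (U \<inter> V)) (\<kappa> \<circ> inv_into U \<psi>)"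
  using assms unfolding smooth_atlas_def by blast+

lemma chart_image_open:
  assumes "smooth_atlas A" "(U, \<psi>) \<in> A" "open W"
  shows "open (\<psi> ` (U \<inter> W))"
proof -
  note h = smooth_atlasD[OF assms(1,2)]
  have "\<psi> ` (U \<inter> W) = \<psi> ` U \<inter> inv_into U \<psi> -` W"
    using h(3) unfolding homeomorphism_def by force
  then show ?thesis
    using continuous_open_preimage[OF _ h(2) assms(3)] h(3) by (auto simp: homeomorphism_def)
qed

lemma smooth_fun_add:
  "smooth_atlas A \<Longrightarrow> smooth_fun A f \<Longrightarrow> smooth_fun A h \<Longrightarrow> smooth_fun A (\<lambda>q. f q + h q)"
  unfolding smooth_fun_def using smooth_atlasD(2) by (fastforce simp: o_def intro: smooth_on_add)

lemma smooth_fun_mult: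
  "smooth_atlas A \<Longrightarrow> smooth_fun A f \<Longrightarrow> smooth_fun A h \<Longrightarrow> smooth_fun A (\<lambda>q. f q * h q)"
  unfolding smooth_fun_def using smooth_atlasD(2) by (fastforce simp: o_def intro: smooth_on_mult)

lemma smooth_fun_const: "smooth_atlas A \<Longrightarrow> smooth_fun A (\<lambda>q. c)"
  unfolding smooth_fun_def using smooth_atlasD(2) by (fastforce simp: o_def intro: smooth_on_const)

lemma smooth_fun_sum:
  "smooth_atlas A \<Longrightarrow> (\<And>i. i \<in> I \<Longrightarrow> smooth_fun A (f i)) \<Longrightarrow> smooth_fun A (\<lambda>q. \<Sum>i\<in>I. f i q)"
  by (induction I rule: infinite_finite_induct) (auto intro: smooth_fun_const smooth_fun_add)

lemma tangent_add:
  "v \<in> tangent_space A p \<Longrightarrow> smooth_fun A f \<Longrightarrow> smooth_fun A h \<Longrightarrow> v (\<lambda>q. f q + h q) = v f + v h"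
  by (simp add: tangent_space_def)

lemma tangent_mult:
  "v \<in> tangent_space A p \<Longrightarrow> smooth_fun A f \<Longrightarrow> smooth_fun A h \<Longrightarrow>
    v (\<lambda>q. f q * h q) = f p * v h + h p * v f"
  by (simp add: tangent_space_def)

lemma tangent_scale: "v \<in> tangent_space A p \<Longrightarrow> smooth_fun A f \<Longrightarrow> v (\<lambda>q. c * f q) = c * v f"
  by (simp add: tangent_space_def)

lemma tangent_not_smooth: "v \<in> tangent_space A p \<Longrightarrow> \<not> smooth_fun A f \<Longrightarrow> v f = 0"
  by (simp add: tangent_space_def)

lemma tangent_const:
  assumes "smooth_atlas A" "v \<in> tangent_space A p"
  shows "v (\<lambda>q. c) = 0"
proof -
  have "v (\<lambda>q. 1) = 0"
    using tangent_mult[OF assms(2) smooth_fun_const[OF assms(1)] smooth_fun_const[OF assms(1)], of 1 1]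
    by simp
  then show ?thesis
    using tangent_scale[OF assms(2) smooth_fun_const[OF assms(1)], of c 1] by simp
qed

lemma tangent_sum:
  assumes "smooth_atlas A" "v \<in> tangent_space A p" "\<And>i. i \<in> I \<Longrightarrow> smooth_fun A (f i)"
  shows "v (\<lambda>q. \<Sum>i\<in>I. f i q) = (\<Sum>i\<in>I. v (f i))"
  using assms(3)
  by (induction I rule: infinite_finite_induct)
    (auto simp: tangent_const[OF assms(1,2)] tangent_add[OF assms(2)] smooth_fun_sum[OF assms(1)])

lemma tangent_space_closed:
  assumes "smooth_atlas A"
  shows "u \<in> tangent_space A p \<Longrightarrow> v \<in> tangent_space A p \<Longrightarrow> tv_add u v \<in> tangent_space A p"
    and "u \<in> tangent_space A p \<Longrightarrow> v \<in> tangent_space A p \<Longrightarrow> tv_diff u v \<in> tangent_space A p"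
    and "u \<in> tangent_space A p \<Longrightarrow> tv_scale c u \<in> tangent_space A p"
    and "tv_zero \<in> tangent_space A p"
  unfolding tangent_space_def tv_add_def tv_diff_def tv_scale_def tv_zero_def
  by (auto simp: algebra_simps)

section \<open>Coordinate fields around a point\<close>

text \<open>Multiplying by a bump function supported in a chart extends the coordinate functions
  and the coordinate vector fields to the whole manifold without changing them to first order
  at the centre of the bump.\<close>

locale chart_ball =
  fixes A :: "('p::{t2_space,second_countable_topology}, 'e::euclidean_space) atlas"
    and U :: "'p set" and \<psi> :: "'p \<Rightarrow> 'e" and p :: 'p and R :: real
  assumes atlas: "smooth_atlas A" and chart: "(U, \<psi>) \<in> A" and p: "p \<in> U" and R: "R > 0"
    and ball: "ball (\<psi> p) R \<subseteq> \<psi> ` U"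
begin

abbreviation "cutoff \<equiv> bump (\<psi> p) (R / 2)"

definition extend :: "('e \<Rightarrow> real) \<Rightarrow> 'p \<Rightarrow> real" where
  "extend F q = (if q \<in> U then cutoff (\<psi> q) * F (\<psi> q) else 0)"

text \<open>The value on non-smooth functions is forced by the convention for tangent vectors.\<close>

definition coord_field :: "'e \<Rightarrow> 'p vfield" where
  "coord_field w q f = (if smooth_fun A f then extend (\<lambda>x. frechet_derivative (f \<circ> inv_into U \<psi>) (at x) w) q else 0)"

definition coord_fun :: "'e \<Rightarrow> 'p \<Rightarrow> real" where
  "coord_fun b = extend (\<lambda>x. (x - \<psi> p) \<bullet> b)"

lemma inv_chart: "q \<in> U \<Longrightarrow> inv_into U \<psi> (\<psi> q) = q"
  using smooth_atlasD(3)[OF atlas chart] by (simp add: homeomorphism_def)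

lemma cutoff_center: "cutoff (\<psi> p) = 1"
  using R by (simp add: bump_center)

lemma cutoff_outside: "x \<notin> ball (\<psi> p) R \<Longrightarrow> cutoff x = 0"
  using R by (auto intro!: bump_outside)

text \<open>Near a point whose chart image lies in the ball, the extension is a composition of smooth
  maps.  Every other point lies outside the preimage of the closed half-size ball; this preimage is
  compact, hence closed because the manifold is Hausdorff, and the extension vanishes off it.\<close>

lemma smooth_extend:
  assumes F: "smooth_on (ball (\<psi> p) R) F"
  shows "smooth_fun A (extend F)"
  unfolding smooth_fun_def
proof clarify
  fix V \<kappa> assume V: "(V, \<kappa>) \<in> A"
  note hV = smooth_atlasD[OF atlas V] and hU = smooth_atlasD[OF atlas chart]
  have invV: "inv_into V \<kappa> (\<kappa> q) = q" if "q \<in> V" for q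
    using hV(3) that by (simp add: homeomorphism_def)
  show "smooth_on (\<kappa> ` V) (extend F \<circ> inv_into V \<kappa>)"
  proof (rule smooth_on_local, clarify)
    fix q assume q: "q \<in> V"
    show "\<exists>T. open T \<and> \<kappa> q \<in> T \<and> smooth_on T (extend F \<circ> inv_into V \<kappa>)"
    proof (cases "q \<in> U \<and> \<psi> q \<in> ball (\<psi> p) R")
      case True
      define W where "W = U \<inter> \<psi> -` ball (\<psi> p) R"
      have "open W"
        unfolding W_def using hU(1,3) by (intro continuous_open_preimage) (auto simp: homeomorphism_def)
      then have op: "open (\<kappa> ` (V \<inter> W))" by (rule chart_image_open[OF atlas V])
      have sm: "smooth_on (\<kappa> ` (V \<inter> W)) (\<psi> \<circ> inv_into V \<kappa>)"
        by (rule smooth_on_subset[OF hV(4)[OF chart]]) (auto simp: W_def)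
      have "smooth_on (\<kappa> ` (V \<inter> W)) (\<lambda>y. (\<lambda>x. cutoff x * F x) ((\<psi> \<circ> inv_into V \<kappa>) y))"
        by (rule smooth_on_compose[OF op open_ball _ sm smooth_on_mult[OF open_ball smooth_on_subset[OF smooth_bump] F]])
          (auto simp: W_def invV)
      then have "smooth_on (\<kappa> ` (V \<inter> W)) (extend F \<circ> inv_into V \<kappa>)"
        by (rule smooth_on_cong[OF op, rotated]) (auto simp: W_def invV extend_def)
      then show ?thesis using op True q by (intro exI[of _ "\<kappa> ` (V \<inter> W)"]) (auto simp: W_def)
    next
      case False
      define K where "K = inv_into U \<psi> ` cball (\<psi> p) (R / 2)"
      have sub: "cball (\<psi> p) (R / 2) \<subseteq> ball (\<psi> p) R" using R by (auto)
      have "compact K"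
        unfolding K_def using hU(3) sub ball
        by (intro compact_continuous_image) (auto simp: homeomorphism_def intro: continuous_on_subset)
      then have "open (- K)" using compact_imp_closed by blast
      then have op: "open (\<kappa> ` (V \<inter> - K))" by (rule chart_image_open[OF atlas V])
      have zero: "extend F q' = 0" if "q' \<notin> K" for q'
      proof (cases "q' \<in> U")
        case True
        then have "\<psi> q' \<notin> cball (\<psi> p) (R / 2)"
          using that inv_chart[OF True] unfolding K_def by (metis imageI)
        then show ?thesis using R by (simp add: extend_def bump_outside)
      qed (simp add: extend_def)
      have "q \<notin> K"
      proof
        assume "q \<in> K"
        then obtain x where x: "x \<in> cball (\<psi> p) (R / 2)" "q = inv_into U \<psi> x" by (auto simp: K_def)
        then have "x \<in> \<psi> ` U" using sub ball by blast
        then have "q \<in> U" "\<psi> q = x" using x by (auto simp: f_inv_into_f inv_into_into)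
        then show False using False x sub by auto
      qed
      moreover have "smooth_on (\<kappa> ` (V \<inter> - K)) (extend F \<circ> inv_into V \<kappa>)"
        by (rule smooth_on_cong[OF op _ smooth_on_const[OF op, of 0]]) (auto simp: invV zero)
      ultimately show ?thesis using op q by (intro exI[of _ "\<kappa> ` (V \<inter> - K)"]) auto
    qed
  qed
qed

lemma smooth_coord_fun: "smooth_fun A (coord_fun b)"
proof -
  have "smooth_on (ball (\<psi> p) R) (\<lambda>x. x \<bullet> b + - (\<psi> p \<bullet> b))"
    by (intro smooth_on_add smooth_on_linear smooth_on_const bounded_linear_inner_left) auto
  then show ?thesis unfolding coord_fun_def by (intro smooth_extend) (simp add: inner_diff_left)
qed

lemma chart_smooth: "smooth_fun A f \<Longrightarrow> smooth_on (\<psi> ` U) (f \<circ> inv_into U \<psi>)"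
  using chart by (auto simp: smooth_fun_def)

lemma chart_deriv:
  "smooth_fun A f \<Longrightarrow> q \<in> U \<Longrightarrow>
    ((f \<circ> inv_into U \<psi>) has_derivative frechet_derivative (f \<circ> inv_into U \<psi>) (at (\<psi> q))) (at (\<psi> q))"
  by (rule smooth_on_differentiable[OF chart_smooth]) auto

lemma coord_field_tangent: "coord_field w q \<in> tangent_space A q"
proof (cases "q \<in> U")
  case False
  then have "coord_field w q = tv_zero" by (auto simp: coord_field_def extend_def tv_zero_def)
  then show ?thesis by (simp add: tangent_space_def tv_zero_def)
next
  case True
  have add: "frechet_derivative ((\<lambda>q. f q + h q) \<circ> inv_into U \<psi>) (at (\<psi> q)) w =
      frechet_derivative (f \<circ> inv_into U \<psi>) (at (\<psi> q)) w + frechet_derivative (h \<circ> inv_into U \<psi>) (at (\<psi> q)) w"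
    if "smooth_fun A f" "smooth_fun A h" for f h
    using fun_cong[OF frechet_derivative_at[OF has_derivative_add[OF chart_deriv[OF that(1) True] chart_deriv[OF that(2) True]]], of w]
    by (simp add: o_def)
  have mult: "frechet_derivative ((\<lambda>q. f q * h q) \<circ> inv_into U \<psi>) (at (\<psi> q)) w =
      f q * frechet_derivative (h \<circ> inv_into U \<psi>) (at (\<psi> q)) w + h q * frechet_derivative (f \<circ> inv_into U \<psi>) (at (\<psi> q)) w"
    if "smooth_fun A f" "smooth_fun A h" for f h
    using fun_cong[OF frechet_derivative_at[OF has_derivative_mult[OF chart_deriv[OF that(1) True] chart_deriv[OF that(2) True]]], of w]
    by (simp add: o_def inv_chart[OF True] mult.commute)
  have scale: "frechet_derivative ((\<lambda>q. c * f q) \<circ> inv_into U \<psi>) (at (\<psi> q)) w =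
      c * frechet_derivative (f \<circ> inv_into U \<psi>) (at (\<psi> q)) w"
    if "smooth_fun A f" for c f
    using fun_cong[OF frechet_derivative_at[OF has_derivative_mult_right[OF chart_deriv[OF that(1) True], of c]], of w]
    by (simp add: o_def)
  show ?thesis
    using True smooth_fun_add[OF atlas] smooth_fun_mult[OF atlas]
      smooth_fun_mult[OF atlas smooth_fun_const[OF atlas]]
    unfolding tangent_space_def
    by (auto simp: coord_field_def extend_def add mult scale algebra_simps)
qed

lemma vector_field_coord_field: "vector_field A (coord_field w)"
  unfolding vector_field_def
proof (intro conjI allI impI coord_field_tangent)
  fix f assume f: "smooth_fun A f"
  have "deriv_along (coord_field w) f = extend (\<lambda>x. frechet_derivative (f \<circ> inv_into U \<psi>) (at x) w)"
    using f by (simp add: deriv_along_def coord_field_def)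
  then show "smooth_fun A (deriv_along (coord_field w) f)"
    using smooth_extend[OF smooth_on_frechet[OF smooth_on_subset[OF chart_smooth[OF f] ball]]] by simp
qed

text \<open>The derivative of the cut-off function contributes nothing, because it is multiplied by the value
  of a coordinate function at the centre, which is zero.  So the coordinate functions detect the
  coordinate fields, and these are linearly independent at \<open>p\<close>.\<close>

lemma coord_field_coord_fun: "coord_field w p (coord_fun b) = w \<bullet> b"
proof -
  have "((\<lambda>x. cutoff x * ((x - \<psi> p) \<bullet> b)) has_derivative (\<lambda>w. cutoff (\<psi> p) * (w \<bullet> b) +
      frechet_derivative cutoff (at (\<psi> p)) w * ((\<psi> p - \<psi> p) \<bullet> b))) (at (\<psi> p))"
    by (intro has_derivative_mult smooth_on_differentiable[OF smooth_bump UNIV_I])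
      (auto intro!: derivative_eq_intros)
  then have *: "((\<lambda>x. cutoff x * ((x - \<psi> p) \<bullet> b)) has_derivative (\<lambda>w. w \<bullet> b)) (at (\<psi> p))"
    by (simp only: cutoff_center diff_self inner_zero_left mult_zero_right add_0_right mult_1_left)
  have "((coord_fun b \<circ> inv_into U \<psi>) has_derivative (\<lambda>w. w \<bullet> b)) (at (\<psi> p))"
    by (rule has_derivative_transform_within_open[OF * smooth_atlasD(2)[OF atlas chart]])
      (use p in \<open>auto simp: coord_fun_def extend_def f_inv_into_f inv_chart\<close>)
  from frechet_derivative_at[OF this, symmetric] show ?thesis
    using p by (simp add: coord_field_def smooth_coord_fun extend_def cutoff_center)
qed

lemma coord_field_add: "coord_field (u + w) p = tv_add (coord_field u p) (coord_field w p)"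
  and coord_field_scale: "coord_field (c *\<^sub>R u) p = tv_scale c (coord_field u p)"
proof -
  have l: "linear (frechet_derivative (f \<circ> inv_into U \<psi>) (at (\<psi> p)))" if "smooth_fun A f" for f
    by (rule has_derivative_linear[OF chart_deriv[OF that p]])
  show "coord_field (u + w) p = tv_add (coord_field u p) (coord_field w p)"
    using linear_add[OF l] by (auto simp: coord_field_def extend_def tv_add_def algebra_simps)
  show "coord_field (c *\<^sub>R u) p = tv_scale c (coord_field u p)"
    using linear_cmul[OF l] by (auto simp: coord_field_def extend_def tv_scale_def)
qed

text \<open>Hadamard's lemma writes \<open>\<rho>\<^sup>2 (f - f p)\<close>, with \<open>\<rho>\<close> the cut-off function, as a sum
  of products of coordinate functions with smooth functions; a derivation at \<open>p\<close> sees only the values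
  of the latter, which are the partial derivatives of \<open>f\<close>.\<close>

lemma tangent_coordinates:
  assumes v: "v \<in> tangent_space A p" and f: "smooth_fun A f"
  shows "v f = (\<Sum>b\<in>Basis. v (coord_fun b) * coord_field b p f)"
proof -
  let ?F = "f \<circ> inv_into U \<psi>"
  obtain G where G: "\<And>b. smooth_on (ball (\<psi> p) R) (G b)"
    and eq: "\<And>x. x \<in> ball (\<psi> p) R \<Longrightarrow> ?F x = ?F (\<psi> p) + (\<Sum>b\<in>Basis. ((x - \<psi> p) \<bullet> b) * G b x)"
    and G0: "\<And>b. G b (\<psi> p) = frechet_derivative ?F (at (\<psi> p)) b"
    by (rule hadamard[OF smooth_on_subset[OF chart_smooth[OF f] ball] R]) (rule that)
  define \<rho> where "\<rho> = extend (\<lambda>x. 1)"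
  have s\<rho>: "smooth_fun A (\<lambda>q. \<rho> q * \<rho> q)"
    unfolding \<rho>_def by (intro smooth_fun_mult atlas smooth_extend smooth_on_const) auto
  have sf: "smooth_fun A (\<lambda>q. f q + - f p)" by (intro smooth_fun_add atlas f smooth_fun_const)
  have \<rho>p: "\<rho> p = 1" using p by (simp add: \<rho>_def extend_def cutoff_center)
  have fp: "?F (\<psi> p) = f p" by (simp add: inv_chart[OF p])
  have "(\<rho> q * \<rho> q) * (f q + - f p) = (\<Sum>b\<in>Basis. coord_fun b q * extend (G b) q)" for q
  proof (cases "q \<in> U \<and> \<psi> q \<in> ball (\<psi> p) R")
    case True
    then have "f q = f p + (\<Sum>b\<in>Basis. ((\<psi> q - \<psi> p) \<bullet> b) * G b (\<psi> q))"
      using eq[of "\<psi> q"] fp by (simp add: inv_chart)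
    then show ?thesis
      using True by (simp add: \<rho>_def extend_def coord_fun_def sum_distrib_left algebra_simps)
  qed (auto simp: \<rho>_def extend_def coord_fun_def cutoff_outside simp del: mem_ball)
  then have "v (\<lambda>q. (\<rho> q * \<rho> q) * (f q + - f p)) = v (\<lambda>q. \<Sum>b\<in>Basis. coord_fun b q * extend (G b) q)"
    by simp
  moreover have "v (\<lambda>q. (\<rho> q * \<rho> q) * (f q + - f p)) = v f"
    unfolding tangent_mult[OF v s\<rho> sf] tangent_add[OF v f smooth_fun_const[OF atlas]]
    by (simp add: tangent_const[OF atlas v] \<rho>p)
  moreover have "v (\<lambda>q. \<Sum>b\<in>Basis. coord_fun b q * extend (G b) q) = (\<Sum>b\<in>Basis. v (coord_fun b) * coord_field b p f)"
  proof (subst tangent_sum[OF atlas v])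
    fix b :: 'e
    show "smooth_fun A (\<lambda>q. coord_fun b q * extend (G b) q)"
      by (intro smooth_fun_mult atlas smooth_coord_fun smooth_extend G)
    have "v (\<lambda>q. coord_fun b q * extend (G b) q) = v (coord_fun b) * coord_field b p f" for b
      unfolding tangent_mult[OF v smooth_coord_fun smooth_extend[OF G]]
      using p f by (simp add: coord_fun_def extend_def coord_field_def cutoff_center G0)
    then show "(\<Sum>b\<in>Basis. v (\<lambda>q. coord_fun b q * extend (G b) q)) = (\<Sum>b\<in>Basis. v (coord_fun b) * coord_field b p f)"
      by simp
  qed
  ultimately show ?thesis by simp
qed

lemma coord_field_sum: "finite I \<Longrightarrow> coord_field (\<Sum>i\<in>I. c i *\<^sub>R w i) p f = (\<Sum>i\<in>I. c i * coord_field (w i) p f)"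
proof (induction I rule: finite_induct)
  case empty
  show ?case using coord_field_scale[of 0 0] by (simp add: tv_scale_def fun_eq_iff)
qed (simp add: coord_field_add coord_field_scale tv_add_def tv_scale_def)

text \<open>Together with \<open>coord_field_coord_fun\<close>, this makes \<open>w \<mapsto> coord_field w p\<close> a linear isomorphism from the
  model space onto the tangent space, along which questions about bases are moved to the model
  space.\<close>

lemma tangent_coord_field:
  assumes v: "v \<in> tangent_space A p"
  shows "v = coord_field (\<Sum>b\<in>Basis. v (coord_fun b) *\<^sub>R b) p"
proof
  fix f
  show "v f = coord_field (\<Sum>b\<in>Basis. v (coord_fun b) *\<^sub>R b) p f"
  proof (cases "smooth_fun A f")
    case True
    then show ?thesis by (simp add: coord_field_sum tangent_coordinates[OF v])
  qed (simp add: coord_field_def tangent_not_smooth[OF v])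
qed

lemma coord_field_eq_zero: "coord_field w p = tv_zero \<Longrightarrow> w = 0"
  using coord_field_coord_fun[of w w] by (simp add: tv_zero_def)

end

lemma chart_ball_exists:
  assumes "smooth_atlas A"
  obtains U \<psi> R where "chart_ball A U \<psi> p R"
proof -
  have "p \<in> (\<Union>(U, \<psi>)\<in>A. U)" using assms by (simp add: smooth_atlas_def)
  then obtain U \<psi> where U: "(U, \<psi>) \<in> A" "p \<in> U" by auto
  then obtain R where "R > 0" "ball (\<psi> p) R \<subseteq> \<psi> ` U"
    using smooth_atlasD(2)[OF assms U(1)] open_contains_ball by blast
  then show ?thesis using that U assms by (simp add: chart_ball_def)
qed

section \<open>Orthonormal frames\<close>

locale pos_def_form =
  fixes G :: "'e::euclidean_space \<Rightarrow> 'e \<Rightarrow> real"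
  assumes sym: "G u v = G v u"
    and add: "G (u + v) w = G u w + G v w"
    and scale: "G (c *\<^sub>R u) w = c * G u w"
    and pos: "u \<noteq> 0 \<Longrightarrow> G u u > 0"
begin

definition orthonormal :: "nat \<Rightarrow> (nat \<Rightarrow> 'e) \<Rightarrow> bool" where
  "orthonormal k F \<longleftrightarrow> (\<forall>i<k. \<forall>j<k. G (F i) (F j) = (if i = j then 1 else 0))"

lemma zero: "G 0 w = 0"
  using scale[of 0 0 w] by simp

lemma diff: "G (u - v) w = G u w - G v w"
  using add[of u "(-1) *\<^sub>R v" w] scale[of "-1" v w] by simp

lemma sum: "finite I \<Longrightarrow> G (\<Sum>i\<in>I. f i) w = (\<Sum>i\<in>I. G (f i) w)"
  by (induction I rule: finite_induct) (auto simp: zero add)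

lemma orthonormal_residual:
  assumes "orthonormal k F" "j < k"
  shows "G (w - (\<Sum>i<k. G w (F i) *\<^sub>R F i)) (F j) = 0"
proof -
  have "(\<Sum>i<k. G w (F i) * G (F i) (F j)) = (\<Sum>i<k. if i = j then G w (F j) else 0)"
    using assms by (intro sum.cong) (auto simp: orthonormal_def)
  then show ?thesis using assms(2) by (simp add: diff sum scale)
qed

text \<open>The Gram-Schmidt step: fewer than \<open>DIM('e)\<close> vectors do not span, and the residual of a vector outside
  their span can be normalised.\<close>

lemma orthonormal_exists: "k \<le> DIM('e) \<Longrightarrow> \<exists>F. orthonormal k F"
proof (induction k)
  case 0
  then show ?case by (simp add: orthonormal_def)
next
  case (Suc k)
  then obtain F where F: "orthonormal k F" by auto
  have "dim (span (F ` {..<k})) \<le> k"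
    using dim_le_card'[of "F ` {..<k}"] card_image_le[of "{..<k}" F] by simp
  then have "span (F ` {..<k}) \<noteq> UNIV" using Suc.prems by (metis Suc_n_not_le_n dim_UNIV le_trans)
  then obtain w where w: "w \<notin> span (F ` {..<k})" by blast
  define d where "d = w - (\<Sum>i<k. G w (F i) *\<^sub>R F i)"
  have "(\<Sum>i<k. G w (F i) *\<^sub>R F i) \<in> span (F ` {..<k})"
    by (intro span_sum span_scale span_base) auto
  then have "d \<noteq> 0" using w by (auto simp: d_def)
  then have pd: "G d d > 0" by (rule pos)
  have od: "G d (F j) = 0" if "j < k" for j
    unfolding d_def by (rule orthonormal_residual[OF F that])
  let ?F = "F(k := (1 / sqrt (G d d)) *\<^sub>R d)"
  have "G (F i) ((1 / sqrt (G d d)) *\<^sub>R d) = 0" if "i < k" for i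
    using od[OF that] by (subst sym) (simp add: scale)
  moreover have "G ((1 / sqrt (G d d)) *\<^sub>R d) ((1 / sqrt (G d d)) *\<^sub>R d) = 1"
    using pd by (simp add: scale sym[of d "_ *\<^sub>R d"])
  ultimately have "orthonormal (Suc k) ?F"
    using F od by (auto simp: orthonormal_def less_Suc_eq scale)
  then show ?case by blast
qed

text \<open>Orthonormal vectors are independent, so \<open>DIM('e)\<close> of them span; the residual of \<open>w\<close> is then
  orthogonal to everything, in particular to itself.\<close>

lemma orthonormal_expansion:
  assumes F: "orthonormal DIM('e) F"
  shows "w = (\<Sum>i<DIM('e). G w (F i) *\<^sub>R F i)"
proof -
  let ?I = "{..<DIM('e)}"
  have inj: "inj_on F ?I"
  proof (rule inj_onI)
    fix i j assume "i \<in> ?I" "j \<in> ?I" "F i = F j"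
    then show "i = j" using F unfolding orthonormal_def by (metis lessThan_iff zero_neq_one)
  qed
  have "independent (F ` ?I)"
  proof
    assume "dependent (F ` ?I)"
    then obtain u v where v: "v \<in> F ` ?I" "u v \<noteq> 0" and s: "(\<Sum>v\<in>F ` ?I. u v *\<^sub>R v) = 0"
      using dependent_finite[of "F ` ?I"] by auto
    obtain j where j: "j < DIM('e)" "v = F j" using v by auto
    have "0 = G (\<Sum>i<DIM('e). u (F i) *\<^sub>R F i) (F j)"
      using s by (simp add: sum.reindex[OF inj] zero)
    also have "\<dots> = (\<Sum>i<DIM('e). u (F i) * G (F i) (F j))" by (simp add: sum scale)
    also have "\<dots> = (\<Sum>i<DIM('e). if i = j then u (F j) else 0)"
      using F j by (intro sum.cong) (auto simp: orthonormal_def)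
    finally show False using v j by simp
  qed
  then have span: "UNIV \<subseteq> span (F ` ?I)"
    by (intro card_ge_dim_independent) (auto simp: card_image[OF inj])
  define d where "d = w - (\<Sum>i<DIM('e). G w (F i) *\<^sub>R F i)"
  have "subspace {x. G d x = 0}"
    by (rule subspaceI) (auto simp: sym[of d] zero add scale)
  moreover have "F ` ?I \<subseteq> {x. G d x = 0}"
    using orthonormal_residual[OF F] by (auto simp: d_def)
  ultimately have "G d d = 0" using span span_minimal by blast
  then have "d = 0" using pos[of d] by fastforce
  then show ?thesis by (simp add: d_def)
qed

end

lemma metric_add_left:
  "riemannian_metric A g \<Longrightarrow> u \<in> tangent_space A p \<Longrightarrow> v \<in> tangent_space A p \<Longrightarrow> w \<in> tangent_space A p \<Longrightarrow>
    g p (tv_add u v) w = g p u w + g p v w"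
  by (simp add: riemannian_metric_def)

lemma metric_scale_left:
  "riemannian_metric A g \<Longrightarrow> u \<in> tangent_space A p \<Longrightarrow> v \<in> tangent_space A p \<Longrightarrow>
    g p (tv_scale c u) v = c * g p u v"
  by (simp add: riemannian_metric_def)

lemma metric_sym:
  "riemannian_metric A g \<Longrightarrow> u \<in> tangent_space A p \<Longrightarrow> v \<in> tangent_space A p \<Longrightarrow> g p u v = g p v u"
  by (simp add: riemannian_metric_def)

lemma metric_pos:
  "riemannian_metric A g \<Longrightarrow> u \<in> tangent_space A p \<Longrightarrow> u \<noteq> tv_zero \<Longrightarrow> g p u u > 0"
  by (simp add: riemannian_metric_def)

context chart_ball
begin

lemma pos_def_form_metric:
  assumes "riemannian_metric A g"
  shows "pos_def_form (\<lambda>u v. g p (coord_field u p) (coord_field v p))"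
proof
  note t = coord_field_tangent[where q = p]
  fix u v w and c :: real
  show "g p (coord_field u p) (coord_field v p) = g p (coord_field v p) (coord_field u p)"
    by (rule metric_sym[OF assms t t])
  show "g p (coord_field (u + v) p) (coord_field w p) =
      g p (coord_field u p) (coord_field w p) + g p (coord_field v p) (coord_field w p)"
    unfolding coord_field_add by (rule metric_add_left[OF assms t t t])
  show "g p (coord_field (c *\<^sub>R u) p) (coord_field w p) = c * g p (coord_field u p) (coord_field w p)"
    unfolding coord_field_scale by (rule metric_scale_left[OF assms t t])
  show "g p (coord_field u p) (coord_field u p) > 0" if "u \<noteq> 0"
    using metric_pos[OF assms t] coord_field_eq_zero that by blast
qed

end

lemma orthonormal_at_exists:
  fixes A :: "('p::{t2_space,second_countable_topology}, 'e::euclidean_space) atlas"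
  assumes "smooth_atlas A" and g: "riemannian_metric A g"
  shows "\<exists>E. orthonormal_at A g p E"
proof -
  obtain U \<psi> R where "chart_ball A U \<psi> p R" using chart_ball_exists[OF assms(1)] by blast
  then interpret chart_ball A U \<psi> p R .
  interpret pos_def_form "\<lambda>u v. g p (coord_field u p) (coord_field v p)"
    by (rule pos_def_form_metric[OF g])
  obtain F where F: "orthonormal DIM('e) F" using orthonormal_exists by blast
  then have "orthonormal_at A g p (\<lambda>i. coord_field (F i))"
    by (simp add: orthonormal_at_def orthonormal_def vector_field_coord_field)
  then show ?thesis by blast
qed

lemma orthonormal_at_expansion:
  fixes A :: "('p::{t2_space,second_countable_topology}, 'e::euclidean_space) atlas"
  assumes "smooth_atlas A" and g: "riemannian_metric A g" and E: "orthonormal_at A g p E"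
    and v: "v \<in> tangent_space A p"
  shows "v f = (\<Sum>i<DIM('e). g p v (E i p) * E i p f)"
proof -
  obtain U \<psi> R where "chart_ball A U \<psi> p R" using chart_ball_exists[OF assms(1)] by blast
  then interpret chart_ball A U \<psi> p R .
  interpret pos_def_form "\<lambda>u v. g p (coord_field u p) (coord_field v p)"
    by (rule pos_def_form_metric[OF g])
  define c where "c u = (\<Sum>b\<in>Basis. u (coord_fun b) *\<^sub>R b)" for u :: "'p tvec"
  have E_tangent: "E i p \<in> tangent_space A p" if "i < DIM('e)" for i
    using E that by (auto simp: orthonormal_at_def vector_field_def)
  have Ec: "coord_field (c (E i p)) p = E i p" if "i < DIM('e)" for i
    using tangent_coord_field[OF E_tangent[OF that]] by (simp add: c_def)
  have vc: "coord_field (c v) p = v"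
    using tangent_coord_field[OF v] by (simp add: c_def)
  have "orthonormal DIM('e) (\<lambda>i. c (E i p))"
    using E by (simp add: orthonormal_def orthonormal_at_def Ec)
  from orthonormal_expansion[OF this, of "c v"]
  have "c v = (\<Sum>i<DIM('e). g p v (E i p) *\<^sub>R c (E i p))" by (simp add: vc Ec)
  then have "coord_field (c v) p f = coord_field (\<Sum>i<DIM('e). g p v (E i p) *\<^sub>R c (E i p)) p f"
    by simp
  then show ?thesis by (simp add: coord_field_sum vc Ec)
qed

section \<open>Fields, metrics and connections\<close>

lemma vector_fieldD: "vector_field A X \<Longrightarrow> X p \<in> tangent_space A p"
  by (simp add: vector_field_def)

lemma smooth_fun_uminus: "smooth_atlas A \<Longrightarrow> smooth_fun A f \<Longrightarrow> smooth_fun A (\<lambda>q. - f q)"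
  using smooth_fun_mult[OF _ smooth_fun_const, of A f "-1"] by simp

lemma vector_field_add:
  assumes "smooth_atlas A" "vector_field A X" "vector_field A Y"
  shows "vector_field A (vf_add X Y)"
proof -
  have "deriv_along (vf_add X Y) f = (\<lambda>q. deriv_along X f q + deriv_along Y f q)" for f
    by (simp add: deriv_along_def vf_add_def tv_add_def)
  then show ?thesis
    using assms smooth_fun_add[OF assms(1)] unfolding vector_field_def
    by (auto simp: vf_add_def tangent_space_closed(1))
qed

lemma vector_field_scale:
  assumes "smooth_atlas A" "smooth_fun A h" "vector_field A X"
  shows "vector_field A (vf_scale h X)"
proof -
  have "deriv_along (vf_scale h X) f = (\<lambda>q. h q * deriv_along X f q)" for f
    by (simp add: deriv_along_def vf_scale_def tv_scale_def)
  then show ?thesis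
    using assms smooth_fun_mult[OF assms(1)] unfolding vector_field_def
    by (auto simp: vf_scale_def tangent_space_closed(3))
qed

lemma vf_diff_eq: "vf_diff X Y = vf_add X (vf_scale (\<lambda>p. -1) Y)"
  by (auto simp: vf_diff_def vf_add_def vf_scale_def tv_diff_def tv_add_def tv_scale_def)

lemma vector_field_diff: "smooth_atlas A \<Longrightarrow> vector_field A X \<Longrightarrow> vector_field A Y \<Longrightarrow> vector_field A (vf_diff X Y)"
  unfolding vf_diff_eq by (intro vector_field_add vector_field_scale smooth_fun_const)

lemma metric_add_right:
  "smooth_atlas A \<Longrightarrow> riemannian_metric A g \<Longrightarrow> u \<in> tangent_space A p \<Longrightarrow> v \<in> tangent_space A p \<Longrightarrow>
    w \<in> tangent_space A p \<Longrightarrow> g p w (tv_add u v) = g p w u + g p w v"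
  using metric_add_left[of A g u p v w] by (simp add: metric_sym[of A g w p] tangent_space_closed)

lemma metric_scale_right:
  "smooth_atlas A \<Longrightarrow> riemannian_metric A g \<Longrightarrow> u \<in> tangent_space A p \<Longrightarrow> v \<in> tangent_space A p \<Longrightarrow>
    g p v (tv_scale c u) = c * g p v u"
  using metric_scale_left[of A g u p v c] by (simp add: metric_sym[of A g v p] tangent_space_closed)

lemma tv_diff_eq: "tv_diff u v = tv_add u (tv_scale (-1) v)"
  by (auto simp: tv_diff_def tv_add_def tv_scale_def)

lemma metric_diff_left:
  "smooth_atlas A \<Longrightarrow> riemannian_metric A g \<Longrightarrow> u \<in> tangent_space A p \<Longrightarrow> v \<in> tangent_space A p \<Longrightarrow>
    w \<in> tangent_space A p \<Longrightarrow> g p (tv_diff u v) w = g p u w - g p v w"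
  by (simp add: tv_diff_eq metric_add_left metric_scale_left tangent_space_closed)

lemma metric_smooth:
  "riemannian_metric A g \<Longrightarrow> vector_field A X \<Longrightarrow> vector_field A Y \<Longrightarrow> smooth_fun A (\<lambda>p. g p (X p) (Y p))"
  by (simp add: riemannian_metric_def)

lemma tv_eq_zeroI:
  assumes "riemannian_metric A g" "u \<in> tangent_space A p" "g p u u = 0"
  shows "u = tv_zero"
  using metric_pos[OF assms(1,2)] assms(3) by fastforce

lemma tv_eqI:
  assumes "smooth_atlas A" "riemannian_metric A g" "u \<in> tangent_space A p" "v \<in> tangent_space A p"
    and "\<And>w. w \<in> tangent_space A p \<Longrightarrow> g p u w = g p v w"
  shows "u = v"
proof -
  have t: "tv_diff u v \<in> tangent_space A p" by (intro tangent_space_closed assms)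
  have "tv_diff u v = tv_zero"
    using assms(5)[OF t] by (intro tv_eq_zeroI[OF assms(2) t]) (simp add: metric_diff_left[OF assms(1-4) t])
  then show ?thesis by (simp add: tv_diff_def tv_zero_def fun_eq_iff)
qed

lemma levi_civitaD:
  assumes "is_levi_civita A g D"
  shows "\<And>X Y. vector_field A X \<Longrightarrow> vector_field A Y \<Longrightarrow> vector_field A (D X Y)"
    and "\<And>X Y Z. vector_field A X \<Longrightarrow> vector_field A Y \<Longrightarrow> vector_field A Z \<Longrightarrow>
      D (vf_add X Y) Z = vf_add (D X Z) (D Y Z)"
    and "\<And>X Y Z. vector_field A X \<Longrightarrow> vector_field A Y \<Longrightarrow> vector_field A Z \<Longrightarrow>
      D Z (vf_add X Y) = vf_add (D Z X) (D Z Y)"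
    and "\<And>h X Y. smooth_fun A h \<Longrightarrow> vector_field A X \<Longrightarrow> vector_field A Y \<Longrightarrow>
      D (vf_scale h X) Y = vf_scale h (D X Y)"
    and "\<And>h X Y. smooth_fun A h \<Longrightarrow> vector_field A X \<Longrightarrow> vector_field A Y \<Longrightarrow>
      D X (vf_scale h Y) = vf_add (vf_scale (deriv_along X h) Y) (vf_scale h (D X Y))"
    and "\<And>X Y. vector_field A X \<Longrightarrow> vector_field A Y \<Longrightarrow> bracket X Y = vf_diff (D X Y) (D Y X)"
    and "\<And>X Y Z p. vector_field A X \<Longrightarrow> vector_field A Y \<Longrightarrow> vector_field A Z \<Longrightarrow>
      X p (\<lambda>p. g p (Y p) (Z p)) = g p (D X Y p) (Z p) + g p (Y p) (D X Z p)"
proof -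
  note * = assms[unfolded is_levi_civita_def affine_connection_def]
  show "X p (\<lambda>p. g p (Y p) (Z p)) = g p (D X Y p) (Z p) + g p (Y p) (D X Z p)"
    if "vector_field A X" "vector_field A Y" "vector_field A Z" for X Y Z p
  proof -
    have "deriv_along X (on_fields g Y Z) = (\<lambda>p. on_fields g (D X Y) Z p + on_fields g Y (D X Z) p)"
      using * that by blast
    from fun_cong[OF this, of p] show ?thesis by (simp add: deriv_along_def on_fields_def)
  qed
qed (use assms in \<open>auto simp: is_levi_civita_def affine_connection_def\<close>)

text \<open>The difference of two Levi-Civita connections, lowered with the metric, is symmetric in
  the first two arguments (no torsion) and antisymmetric in the last two (compatibility),
  hence zero.\<close>

lemma levi_civita_unique:
  assumes at: "smooth_atlas A" and g: "riemannian_metric A g"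
    and D: "is_levi_civita A g D" and D': "is_levi_civita A g D'"
    and X: "vector_field A X" and Y: "vector_field A Y"
  shows "D X Y = D' X Y"
proof
  fix p
  note lc = levi_civitaD[OF D] and lc' = levi_civitaD[OF D']
  define s where "s X Y Z = g p (D X Y p) (Z p) - g p (D' X Y p) (Z p)" for X Y Z
  have anti: "s X Y Z = - s X Z Y" if "vector_field A X" "vector_field A Y" "vector_field A Z" for X Y Z
    using lc(7)[OF that, of p] lc'(7)[OF that, of p] that
      metric_sym[OF g vector_fieldD[OF lc(1)[OF that(1,3)]] vector_fieldD[OF that(2)], of p]
      metric_sym[OF g vector_fieldD[OF lc'(1)[OF that(1,3)]] vector_fieldD[OF that(2)], of p]
    by (simp add: s_def)
  have sym: "s X Y Z = s Y X Z" if "vector_field A X" "vector_field A Y" "vector_field A Z" for X Y Z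
  proof -
    have "vf_diff (D X Y) (D Y X) = vf_diff (D' X Y) (D' Y X)" using that lc(6) lc'(6) by metis
    then have "tv_diff (D X Y p) (D Y X p) = tv_diff (D' X Y p) (D' Y X p)"
      by (simp add: vf_diff_def fun_eq_iff)
    then have "g p (tv_diff (D X Y p) (D Y X p)) (Z p) = g p (tv_diff (D' X Y p) (D' Y X p)) (Z p)"
      by simp
    then show ?thesis
      using that by (simp add: s_def metric_diff_left[OF at g] vector_fieldD lc(1) lc'(1))
  qed
  have s0: "s X Y Z = 0" if "vector_field A X" "vector_field A Y" "vector_field A Z" for X Y Z
    using anti[of X Y Z] anti[of Y Z X] anti[of Z X Y] sym[of X Y Z] sym[of Y Z X] sym[of Z X Y] that
    by simp
  let ?W = "vf_diff (D X Y) (D' X Y)"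
  have W: "vector_field A ?W" by (intro vector_field_diff at lc(1) lc'(1) X Y)
  have "g p (?W p) (?W p) = s X Y ?W"
    using vector_fieldD[OF W, of p] vector_fieldD[OF lc(1)[OF X Y]] vector_fieldD[OF lc'(1)[OF X Y]]
    by (simp add: s_def vf_diff_def metric_diff_left[OF at g])
  then have "?W p = tv_zero" using s0[OF X Y W] by (intro tv_eq_zeroI[OF g vector_fieldD[OF W]]) simp
  then show "D X Y p = D' X Y p" by (simp add: vf_diff_def tv_diff_def tv_zero_def fun_eq_iff)
qed

text \<open>The connection \<open>levi_civita A g\<close> is an arbitrary choice; by uniqueness it agrees on vector fields with any
  Levi-Civita connection at hand.\<close>

lemma levi_civita_eq:
  assumes "smooth_atlas A" "riemannian_metric A g" "is_levi_civita A g D"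
    and "vector_field A X" "vector_field A Y"
  shows "levi_civita A g X Y = D X Y"
proof -
  have "is_levi_civita A g (levi_civita A g)"
    unfolding levi_civita_def by (rule someI[of "is_levi_civita A g", OF assms(3)])
  from levi_civita_unique[OF assms(1,2) this assms(3-5)] show ?thesis .
qed

lemma curvature_eq:
  assumes "smooth_atlas A" "riemannian_metric A g" and D: "is_levi_civita A g D"
    and "vector_field A X" "vector_field A Y" "vector_field A Z"
  shows "curvature A g X Y Z = vf_diff (vf_diff (D X (D Y Z)) (D Y (D X Z))) (D (bracket X Y) Z)"
proof -
  note lc = levi_civitaD[OF D] and eq = levi_civita_eq[OF assms(1,2) D]
  have "vector_field A (bracket X Y)"
    using assms lc(1,6) by (simp add: vector_field_diff)
  then show ?thesis using assms lc(1) by (simp add: curvature_def Let_def eq)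
qed

lemma vector_field_curvature:
  assumes at: "smooth_atlas A" and g: "riemannian_metric A g" and D: "is_levi_civita A g D"
    and "vector_field A X" "vector_field A Y" "vector_field A Z"
  shows "vector_field A (curvature A g X Y Z)"
proof -
  have "vector_field A (bracket X Y)"
    unfolding levi_civitaD(6)[OF D assms(4,5)] by (intro vector_field_diff at levi_civitaD(1)[OF D] assms(4-6))
  then show ?thesis
    unfolding curvature_eq[OF assms] by (intro vector_field_diff at levi_civitaD(1)[OF D] assms(4-6))
qed

lemma orthonormal_at_linear_expansion:
  fixes A :: "('p::{t2_space,second_countable_topology}, 'e::euclidean_space) atlas"
  assumes at: "smooth_atlas A" and g: "riemannian_metric A g" and E: "orthonormal_at A g p E"
    and v: "v \<in> tangent_space A p"
    and add: "\<And>u w. u \<in> tangent_space A p \<Longrightarrow> w \<in> tangent_space A p \<Longrightarrow> T (tv_add u w) = T u + T w"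
    and scale: "\<And>c u. u \<in> tangent_space A p \<Longrightarrow> T (tv_scale c u) = c * (T u :: real)"
  shows "T v = (\<Sum>i<DIM('e). g p v (E i p) * T (E i p))"
proof -
  have Et: "E i p \<in> tangent_space A p" if "i < DIM('e)" for i
    using E that by (auto simp: orthonormal_at_def vector_field_def)
  have "(\<lambda>f. \<Sum>i<k. c i * E i p f) \<in> tangent_space A p \<and>
      T (\<lambda>f. \<Sum>i<k. c i * E i p f) = (\<Sum>i<k. c i * T (E i p))" if "k \<le> DIM('e)" for k c
    using that
  proof (induction k)
    case 0
    have "tv_scale 0 v = tv_zero" by (simp add: tv_scale_def tv_zero_def)
    then have "T tv_zero = 0" using scale[OF v, of 0] by simp
    then show ?case
      using tangent_space_closed(4)[OF at] by (simp add: tv_zero_def)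
  next
    case (Suc k)
    have "(\<lambda>f. \<Sum>i<Suc k. c i * E i p f) = tv_add (\<lambda>f. \<Sum>i<k. c i * E i p f) (tv_scale (c k) (E k p))"
      by (auto simp: tv_add_def tv_scale_def)
    then show ?case
      using Suc Et[of k] by (simp add: add scale tangent_space_closed[OF at])
  qed
  from this[of "DIM('e)" "\<lambda>i. g p v (E i p)"]
  have "T (\<lambda>f. \<Sum>i<DIM('e). g p v (E i p) * E i p f) = (\<Sum>i<DIM('e). g p v (E i p) * T (E i p))"
    by simp
  moreover have "v = (\<lambda>f. \<Sum>i<DIM('e). g p v (E i p) * E i p f)"
    using orthonormal_at_expansion[OF at g E v] by blast
  ultimately show ?thesis by simp
qed

text \<open>The vector \<open>\<Sum> e\<^sub>i(f) e\<^sub>i\<close>, for an orthonormal frame \<open>e\<^sub>i\<close>, represents the differential of \<open>f\<close>, and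
  it is the only vector that does; so the description that defines the gradient denotes it.\<close>

lemma gradient_metric:
  fixes A :: "('p::{t2_space,second_countable_topology}, 'e::euclidean_space) atlas"
  assumes at: "smooth_atlas A" and g: "riemannian_metric A g" and f: "smooth_fun A f"
    and u: "u \<in> tangent_space A p"
  shows "g p (gradient A g f p) u = u f"
proof -
  obtain E where E: "orthonormal_at A g p E" using orthonormal_at_exists[OF at g] by blast
  define v where "v k = (\<lambda>h. \<Sum>i<k. E i p f * E i p h)" for k
  have Et: "E i p \<in> tangent_space A p" if "i < DIM('e)" for i
    using E that by (auto simp: orthonormal_at_def vector_field_def)
  have "v k \<in> tangent_space A p \<and> (\<forall>u\<in>tangent_space A p. g p (v k) u = (\<Sum>i<k. E i p f * g p (E i p) u))"
    if "k \<le> DIM('e)" for k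
    using that
  proof (induction k)
    case 0
    have v0: "v 0 = tv_scale 0 u" by (simp add: v_def tv_scale_def)
    show ?case unfolding v0 using u by (simp add: tangent_space_closed[OF at] metric_scale_left[OF g u])
  next
    case (Suc k)
    have "v (Suc k) = tv_add (v k) (tv_scale (E k p f) (E k p))"
      by (auto simp: v_def tv_add_def tv_scale_def)
    then show ?case
      using Suc Et[of k] by (simp add: metric_add_left[OF g] metric_scale_left[OF g] tangent_space_closed[OF at])
  qed
  then have v: "v DIM('e) \<in> tangent_space A p"
    and gv: "g p (v DIM('e)) u = (\<Sum>i<DIM('e). E i p f * g p (E i p) u)" if "u \<in> tangent_space A p" for u
    using that by auto
  have grad: "g p (v DIM('e)) u = u f" if u: "u \<in> tangent_space A p" for u
  proof -
    have "(\<Sum>i<DIM('e). E i p f * g p (E i p) u) = (\<Sum>i<DIM('e). g p u (E i p) * E i p f)"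
      by (intro sum.cong) (auto simp: metric_sym[OF g Et u])
    then show ?thesis using gv[OF u] orthonormal_at_expansion[OF at g E u, of f] by simp
  qed
  have "gradient A g f p \<in> tangent_space A p \<and> (\<forall>u\<in>tangent_space A p. g p (gradient A g f p) u = u f)"
    unfolding gradient_def
  proof (rule theI[of _ "v DIM('e)"])
    show "v DIM('e) \<in> tangent_space A p \<and> (\<forall>u\<in>tangent_space A p. g p (v DIM('e)) u = u f)"
      using v[OF u] grad by blast
    fix w assume "w \<in> tangent_space A p \<and> (\<forall>u\<in>tangent_space A p. g p w u = u f)"
    then show "w = v DIM('e)" using v[OF u] grad by (intro tv_eqI[OF at g]) auto
  qed
  then show ?thesis using u by blast
qed

section \<open>Kenmotsu manifolds\<close>

locale kenmotsu_manifold =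
  fixes A :: "('p::{t2_space,second_countable_topology}, 'e::euclidean_space) atlas"
    and \<phi> :: "'p endo" and \<xi> :: "'p vfield" and \<eta> :: "'p oneform" and g :: "'p metric"
    and D :: "'p connection"
  assumes contact: "almost_contact_metric A \<phi> \<xi> \<eta> g"
    and D: "is_levi_civita A g D"
    and nabla_phi: "\<And>X Y. vector_field A X \<Longrightarrow> vector_field A Y \<Longrightarrow>
      vf_diff (D X (apply_endo \<phi> Y)) (apply_endo \<phi> (D X Y)) =
      vf_diff (vf_scale (on_fields g (apply_endo \<phi> X) Y) \<xi>) (vf_scale (\<lambda>p. \<eta> p (Y p)) (apply_endo \<phi> X))"
begin

lemma atlas: "smooth_atlas A" and metric: "riemannian_metric A g"
  and xi: "vector_field A \<xi>" and eta_xi: "\<eta> p (\<xi> p) = 1"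
  and eta: "u \<in> tangent_space A p \<Longrightarrow> \<eta> p u = g p (\<xi> p) u"
  and phi_tangent: "u \<in> tangent_space A p \<Longrightarrow> \<phi> p u \<in> tangent_space A p"
  and phi_scale: "u \<in> tangent_space A p \<Longrightarrow> \<phi> p (tv_scale c u) = tv_scale c (\<phi> p u)"
  and phi_add: "u \<in> tangent_space A p \<Longrightarrow> v \<in> tangent_space A p \<Longrightarrow> \<phi> p (tv_add u v) = tv_add (\<phi> p u) (\<phi> p v)"
  and phi_phi: "u \<in> tangent_space A p \<Longrightarrow> \<phi> p (\<phi> p u) = tv_add (tv_scale (-1) u) (tv_scale (\<eta> p u) (\<xi> p))"
  and metric_phi: "u \<in> tangent_space A p \<Longrightarrow> v \<in> tangent_space A p \<Longrightarrow> g p (\<phi> p u) (\<phi> p v) = g p u v - \<eta> p u * \<eta> p v"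
  using contact unfolding almost_contact_metric_def tensor_field_11_def by blast+

lemmas lc = levi_civitaD[OF D]
lemmas tangent = vector_fieldD
lemmas closed = tangent_space_closed[OF atlas]
lemmas xi_tangent = vector_fieldD[OF xi]

lemma eta_add: "u \<in> tangent_space A p \<Longrightarrow> v \<in> tangent_space A p \<Longrightarrow> \<eta> p (tv_add u v) = \<eta> p u + \<eta> p v"
  and eta_scale: "u \<in> tangent_space A p \<Longrightarrow> \<eta> p (tv_scale c u) = c * \<eta> p u"
  using contact unfolding almost_contact_metric_def one_form_def by blast+

lemma eta_diff: "u \<in> tangent_space A p \<Longrightarrow> v \<in> tangent_space A p \<Longrightarrow> \<eta> p (tv_diff u v) = \<eta> p u - \<eta> p v"
  by (simp add: tv_diff_eq eta_add eta_scale closed)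

lemma eta_smooth: "vector_field A X \<Longrightarrow> smooth_fun A (\<lambda>p. \<eta> p (X p))"
  using contact unfolding almost_contact_metric_def one_form_def by blast

lemma phi_xi: "\<phi> p (\<xi> p) = tv_zero"
  using metric_phi[OF xi_tangent xi_tangent, of p] eta[OF xi_tangent, of p] eta_xi
  by (intro tv_eq_zeroI[OF metric phi_tangent[OF xi_tangent]]) simp

text \<open>Compare the two ways of computing \<open>\<phi>\<^sup>3 u\<close>.\<close>

lemma eta_phi:
  assumes "u \<in> tangent_space A p"
  shows "\<eta> p (\<phi> p u) = 0"
proof -
  have "\<phi> p (\<phi> p (\<phi> p u)) = tv_add (tv_scale (-1) (\<phi> p u)) (tv_scale (\<eta> p (\<phi> p u)) (\<xi> p))"
    by (rule phi_phi[OF phi_tangent[OF assms]])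
  moreover have "\<phi> p (\<phi> p (\<phi> p u)) = tv_scale (-1) (\<phi> p u)"
    unfolding phi_phi[OF assms]
    using assms by (simp add: phi_add phi_scale closed xi_tangent phi_xi) (simp add: tv_add_def tv_scale_def tv_zero_def)
  ultimately have "tv_scale (\<eta> p (\<phi> p u)) (\<xi> p) = tv_zero"
    by (simp add: tv_add_def tv_scale_def tv_zero_def fun_eq_iff)
  then have "\<eta> p (tv_scale (\<eta> p (\<phi> p u)) (\<xi> p)) = \<eta> p tv_zero" by simp
  also have "\<eta> p tv_zero = 0"
    using eta_scale[OF xi_tangent, of p 0] by (simp add: tv_scale_def tv_zero_def)
  finally show ?thesis by (simp add: eta_scale xi_tangent eta_xi)
qed

lemma D_zero: "vector_field A X \<Longrightarrow> D X (\<lambda>p. tv_zero) = (\<lambda>p. tv_zero)"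
  using lc(5)[OF smooth_fun_const[OF atlas, of 0] _ xi, of X] tangent_const[OF atlas tangent, of X _ 0]
  by (auto simp: vf_scale_def vf_add_def tv_scale_def tv_add_def tv_zero_def deriv_along_def)

lemma eta_nabla_xi: "vector_field A X \<Longrightarrow> \<eta> p (D X \<xi> p) = 0"
proof -
  assume X: "vector_field A X"
  have t: "D X \<xi> p \<in> tangent_space A p" by (rule tangent[OF lc(1)[OF X xi]])
  have "X p (\<lambda>p. g p (\<xi> p) (\<xi> p)) = 0"
    using eta[OF xi_tangent] tangent_const[OF atlas tangent[OF X], of p 1] by (simp add: eta_xi)
  then show ?thesis
    using lc(7)[OF X xi xi, of p] metric_sym[OF metric t xi_tangent] eta[OF t] by simp
qed

text \<open>Evaluate the structure equation at \<open>Y = \<xi>\<close>: it says that \<open>\<phi>\<close> annihilates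
  \<open>\<nabla>\<^sub>X \<xi> - X\<close>, so this vector is a multiple of \<open>\<xi>\<close>; since \<open>\<xi>\<close> is a unit field the multiple is
  \<open>- \<eta> X\<close>.\<close>

lemma nabla_xi:
  assumes X: "vector_field A X"
  shows "D X \<xi> = vf_diff X (vf_scale (\<lambda>p. \<eta> p (X p)) \<xi>)"
proof
  fix p
  let ?W = "D X \<xi> p"
  have tX: "X p \<in> tangent_space A p" and tW: "?W \<in> tangent_space A p"
    by (intro tangent X lc(1) xi)+
  have "apply_endo \<phi> \<xi> = (\<lambda>p. tv_zero)" by (auto simp: apply_endo_def phi_xi)
  then have "tv_diff tv_zero (\<phi> p ?W) = tv_diff (tv_scale (g p (\<phi> p (X p)) (\<xi> p)) (\<xi> p)) (tv_scale 1 (\<phi> p (X p)))"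
    using fun_cong[OF nabla_phi[OF X xi], of p]
    by (simp add: D_zero[OF X] vf_diff_def apply_endo_def vf_scale_def on_fields_def eta_xi)
  moreover have "g p (\<phi> p (X p)) (\<xi> p) = 0"
    using metric_sym[OF metric phi_tangent[OF tX] xi_tangent] eta[OF phi_tangent[OF tX]] eta_phi[OF tX] by simp
  ultimately have "\<phi> p ?W = \<phi> p (X p)"
    by (simp add: tv_diff_def tv_zero_def tv_scale_def fun_eq_iff)
  then have "\<phi> p (\<phi> p ?W) = \<phi> p (\<phi> p (X p))" by simp
  then show "?W = vf_diff X (vf_scale (\<lambda>p. \<eta> p (X p)) \<xi>) p"
    unfolding phi_phi[OF tX] phi_phi[OF tW] eta_nabla_xi[OF X]
    by (simp add: vf_diff_def vf_scale_def tv_add_def tv_diff_def tv_scale_def fun_eq_iff)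
      (metis add.commute add_diff_cancel_right' diff_add_cancel minus_diff_eq uminus_add_conv_diff)
qed

text \<open>\<open>horiz\<close> is the restriction of the metric to the contact distribution.\<close>

definition horiz :: "'p tensor2" where
  "horiz X Y p = g p (X p) (Y p) - \<eta> p (X p) * \<eta> p (Y p)"

lemma horiz_sym: "vector_field A X \<Longrightarrow> vector_field A Y \<Longrightarrow> horiz X Y p = horiz Y X p"
  by (simp add: horiz_def metric_sym[OF metric tangent tangent])

lemma horiz_add: "vector_field A X \<Longrightarrow> vector_field A Y \<Longrightarrow> vector_field A Z \<Longrightarrow>
    horiz (vf_add X Y) Z p = horiz X Z p + horiz Y Z p"
  by (simp add: horiz_def vf_add_def metric_add_left[OF metric] eta_add tangent algebra_simps)

lemma horiz_diff: "vector_field A X \<Longrightarrow> vector_field A Y \<Longrightarrow> vector_field A Z \<Longrightarrow>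
    horiz (vf_diff X Y) Z p = horiz X Z p - horiz Y Z p"
  by (simp add: horiz_def vf_diff_def metric_diff_left[OF atlas metric] eta_diff tangent algebra_simps)

lemma horiz_scale: "vector_field A X \<Longrightarrow> vector_field A Z \<Longrightarrow> horiz (vf_scale h X) Z p = h p * horiz X Z p"
  by (simp add: horiz_def vf_scale_def metric_scale_left[OF metric] eta_scale tangent algebra_simps)

lemma horiz_xi: "vector_field A X \<Longrightarrow> horiz \<xi> X p = 0"
  by (simp add: horiz_def eta_xi eta tangent)

lemma horiz_smooth: "vector_field A X \<Longrightarrow> vector_field A Y \<Longrightarrow> smooth_fun A (horiz X Y)"
  using smooth_fun_add[OF atlas metric_smooth[OF metric] smooth_fun_uminus[OF atlas smooth_fun_mult[OF atlas eta_smooth eta_smooth]]]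
  by (simp add: horiz_def[abs_def])

text \<open>In other words, the covariant derivative of \<open>\<eta>\<close> is \<open>horiz\<close>.\<close>

lemma deriv_eta:
  assumes X: "vector_field A X" and Y: "vector_field A Y"
  shows "X p (\<lambda>p. \<eta> p (Y p)) = horiz X Y p + \<eta> p (D X Y p)"
proof -
  have "(\<lambda>p. \<eta> p (Y p)) = (\<lambda>p. g p (\<xi> p) (Y p))" by (simp add: eta tangent[OF Y])
  then have "X p (\<lambda>p. \<eta> p (Y p)) = g p (D X \<xi> p) (Y p) + g p (\<xi> p) (D X Y p)"
    using lc(7)[OF X xi Y, of p] by simp
  then show ?thesis
    by (simp add: nabla_xi[OF X] vf_diff_def vf_scale_def metric_diff_left[OF atlas metric]
        metric_scale_left[OF metric] tangent X Y xi closed lc(1) eta horiz_def)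
qed

lemma deriv_horiz:
  assumes X: "vector_field A X" and Y: "vector_field A Y" and Z: "vector_field A Z"
  shows "X p (horiz Y Z) = horiz (D X Y) Z p + horiz Y (D X Z) p
    - (horiz X Y p * \<eta> p (Z p) + horiz X Z p * \<eta> p (Y p))"
proof -
  have "X p (horiz Y Z) = X p (\<lambda>p. g p (Y p) (Z p) + (-1) * (\<eta> p (Y p) * \<eta> p (Z p)))"
    by (simp add: horiz_def[abs_def])
  also have "\<dots> = X p (\<lambda>p. g p (Y p) (Z p)) +
      (-1) * (\<eta> p (Y p) * X p (\<lambda>p. \<eta> p (Z p)) + \<eta> p (Z p) * X p (\<lambda>p. \<eta> p (Y p)))"
    by (simp only: tangent_add[OF tangent[OF X]] tangent_scale[OF tangent[OF X]] tangent_mult[OF tangent[OF X]]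
        metric_smooth[OF metric Y Z] smooth_fun_mult[OF atlas] smooth_fun_const[OF atlas] eta_smooth Y Z)
  finally show ?thesis
    unfolding lc(7)[OF X Y Z] deriv_eta[OF X Y] deriv_eta[OF X Z]
    by (simp add: horiz_def algebra_simps)
qed

text \<open>Differentiating \<open>\<nabla>\<^sub>Y \<xi> = Y - \<eta>(Y) \<xi>\<close> once more, the symmetric terms \<open>horiz X Y\<close> cancel, and the torsion-free
  connection absorbs the bracket.  The trace of this identity is where \<open>Ric(\<xi>,\<xi>) = -2n\<close> comes from.\<close>

lemma curvature_xi:
  assumes X: "vector_field A X" and Y: "vector_field A Y"
  shows "curvature A g X Y \<xi> p = tv_diff (tv_scale (\<eta> p (X p)) (Y p)) (tv_scale (\<eta> p (Y p)) (X p))"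
proof
  fix f
  have DD: "D X (D Y \<xi>) p f = D X Y p f - (horiz X Y p + \<eta> p (D X Y p)) * \<xi> p f
      - \<eta> p (Y p) * (X p f - \<eta> p (X p) * \<xi> p f)"
    if X: "vector_field A X" and Y: "vector_field A Y" for X Y
  proof -
    have s: "vector_field A (vf_scale (\<lambda>p. \<eta> p (Y p)) \<xi>)"
      by (intro vector_field_scale atlas eta_smooth Y xi)
    have "D X (D Y \<xi>) = vf_add (D X Y) (D X (vf_scale (\<lambda>p. -1) (vf_scale (\<lambda>p. \<eta> p (Y p)) \<xi>)))"
      unfolding nabla_xi[OF Y] vf_diff_eq
      by (rule lc(3)[OF Y vector_field_scale[OF atlas smooth_fun_const[OF atlas] s] X])
    then show ?thesis
      unfolding lc(5)[OF smooth_fun_const[OF atlas] X s] lc(5)[OF eta_smooth[OF Y] X xi] nabla_xi[OF X]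
      by (simp add: vf_add_def vf_scale_def vf_diff_def tv_add_def tv_scale_def tv_diff_def deriv_along_def
          deriv_eta[OF X Y] tangent_const[OF atlas tangent[OF X]] algebra_simps)
  qed
  have br: "vector_field A (bracket X Y)"
    unfolding lc(6)[OF X Y] by (intro vector_field_diff atlas lc(1) X Y)
  have e: "\<eta> p (D X Y p) = \<eta> p (D Y X p) + \<eta> p (bracket X Y p)" "D X Y p f = D Y X p f + bracket X Y p f"
    unfolding lc(6)[OF X Y] by (simp_all add: vf_diff_def eta_diff tangent lc(1) X Y) (simp add: tv_diff_def)
  show "curvature A g X Y \<xi> p f =
      tv_diff (tv_scale (\<eta> p (X p)) (Y p)) (tv_scale (\<eta> p (Y p)) (X p)) f"
    unfolding curvature_eq[OF atlas metric D X Y xi] nabla_xi[OF br]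
    by (simp add: vf_diff_def tv_diff_def DD[OF X Y] DD[OF Y X] vf_scale_def tv_scale_def
        horiz_sym[OF X Y] e algebra_simps)
qed

end

section \<open>The deformed metric\<close>

text \<open>A final \<open>b\<close> marks the objects that belong to the deformed metric: \<open>gb\<close> is the metric, \<open>Db\<close> its
  connection and, further below, \<open>Hb\<close> a Hessian.\<close>

locale deformed_kenmotsu = kenmotsu_manifold A \<phi> \<xi> \<eta> g D
  for A :: "('p::{t2_space,second_countable_topology}, 'e::euclidean_space) atlas"
    and \<phi> \<xi> \<eta> g D +
  fixes a :: real
  assumes a: "a > 0"
begin

definition gb :: "'p metric" where
  "gb = (\<lambda>p u v. a * g p u v + a * (a - 1) * (\<eta> p u * \<eta> p v))"

definition b :: real where "b = (a - 1) / a"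

definition Db :: "'p connection" where
  "Db X Y = vf_add (D X Y) (vf_scale (\<lambda>p. b * horiz X Y p) \<xi>)"

text \<open>Positivity: \<open>gb(u,u) = a g(\<phi> u, \<phi> u) + a\<^sup>2 \<eta>(u)\<^sup>2\<close>, and both terms can vanish only together with
  \<open>g(u,u)\<close>.\<close>

lemma gb_riemannian: "riemannian_metric A gb"
proof -
  have "gb p u u > 0" if "u \<in> tangent_space A p" "u \<noteq> tv_zero" for p u
  proof -
    have "g p u u - \<eta> p u * \<eta> p u = g p (\<phi> p u) (\<phi> p u)" by (simp add: metric_phi that)
    also have "\<dots> \<ge> 0"
    proof (cases "\<phi> p u = tv_zero")
      case True
      have "g p (tv_scale 0 u) (\<phi> p u) = 0" by (simp add: metric_scale_left[OF metric] that phi_tangent)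
      then show ?thesis by (simp add: True tv_scale_def tv_zero_def)
    qed (simp add: metric_pos[OF metric] phi_tangent that less_imp_le)
    finally have *: "g p u u - \<eta> p u * \<eta> p u \<ge> 0" .
    have gu: "g p u u > 0" using metric_pos[OF metric] that by blast
    have "a * (g p u u - \<eta> p u * \<eta> p u) + a\<^sup>2 * (\<eta> p u * \<eta> p u) > 0"
    proof (cases "\<eta> p u = 0")
      case True
      then show ?thesis using gu a by simp
    next
      case False
      then have "\<eta> p u * \<eta> p u > 0" by (auto simp: zero_less_mult_iff linorder_neq_iff)
      from mult_pos_pos[OF _ this, of "a\<^sup>2"] have "a\<^sup>2 * (\<eta> p u * \<eta> p u) > 0" using a by simp
      then show ?thesis using a * by (intro add_nonneg_pos mult_nonneg_nonneg) auto
    qed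
    then show ?thesis by (simp add: gb_def power2_eq_square algebra_simps)
  qed
  moreover have "smooth_fun A (\<lambda>p. gb p (X p) (Y p))" if "vector_field A X" "vector_field A Y" for X Y
    unfolding gb_def
    by (intro smooth_fun_add smooth_fun_mult smooth_fun_const atlas eta_smooth metric_smooth[OF metric] that)
  ultimately show ?thesis
    unfolding riemannian_metric_def
    by (auto simp: gb_def metric_add_left[OF metric] metric_scale_left[OF metric] eta_add eta_scale
        metric_sym[OF metric] algebra_simps)
qed

lemma Db_closed: "vector_field A X \<Longrightarrow> vector_field A Y \<Longrightarrow> vector_field A (Db X Y)"
  unfolding Db_def
  by (intro vector_field_add vector_field_scale smooth_fun_mult smooth_fun_const horiz_smooth atlas lc(1) xi)

lemma horiz_add_right: "vector_field A X \<Longrightarrow> vector_field A Y \<Longrightarrow> vector_field A Z \<Longrightarrow>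
    horiz Z (vf_add X Y) p = horiz Z X p + horiz Z Y p"
  by (simp add: horiz_add horiz_sym[of Z] vector_field_add[OF atlas])

lemma horiz_scale_right: "vector_field A X \<Longrightarrow> vector_field A Z \<Longrightarrow> smooth_fun A h \<Longrightarrow>
    horiz Z (vf_scale h X) p = h p * horiz Z X p"
  by (simp add: horiz_scale horiz_sym[of Z] vector_field_scale[OF atlas])

lemma gb_xi: "u \<in> tangent_space A p \<Longrightarrow> gb p (\<xi> p) u = a\<^sup>2 * \<eta> p u"
  by (simp add: gb_def eta_xi eta[symmetric] power2_eq_square algebra_simps)

text \<open>Since \<open>\<nabla>\<^sub>X \<eta> = horiz X\<close> is symmetric, only its product with \<open>\<eta>\<close> survives in the Koszul
  formula for the deformed metric, and the correction term of the connection points along \<open>\<xi>\<close>.\<close>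

lemma Db_levi_civita: "is_levi_civita A gb Db"
  unfolding is_levi_civita_def affine_connection_def
proof (intro conjI allI impI Db_closed)
  fix X Y Z assume X: "vector_field A X" and Y: "vector_field A Y" and Z: "vector_field A Z"
  show "Db (vf_add X Y) Z = vf_add (Db X Z) (Db Y Z)"
    by (simp add: Db_def lc(2) X Y Z horiz_add)
      (simp add: vf_add_def vf_scale_def tv_add_def tv_scale_def algebra_simps)
  show "Db Z (vf_add X Y) = vf_add (Db Z X) (Db Z Y)"
    by (simp add: Db_def lc(3) X Y Z horiz_add_right)
      (simp add: vf_add_def vf_scale_def tv_add_def tv_scale_def algebra_simps)
next
  fix h X Y assume h: "smooth_fun A h" and X: "vector_field A X" and Y: "vector_field A Y"
  show "Db (vf_scale h X) Y = vf_scale h (Db X Y)"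
    by (simp add: Db_def lc(4) h X Y horiz_scale)
      (simp add: vf_add_def vf_scale_def tv_add_def tv_scale_def algebra_simps)
  show "Db X (vf_scale h Y) = vf_add (vf_scale (deriv_along X h) Y) (vf_scale h (Db X Y))"
    by (simp add: Db_def lc(5) h X Y horiz_scale_right)
      (simp add: vf_add_def vf_scale_def tv_add_def tv_scale_def algebra_simps)
next
  fix X Y assume X: "vector_field A X" and Y: "vector_field A Y"
  show "vf_diff (Db X Y) (Db Y X) = bracket X Y"
    unfolding lc(6)[OF X Y]
    by (simp add: Db_def vf_add_def vf_diff_def vf_scale_def tv_add_def tv_diff_def tv_scale_def horiz_sym[OF X Y])
next
  fix X Y Z assume X: "vector_field A X" and Y: "vector_field A Y" and Z: "vector_field A Z"
  show "deriv_along X (on_fields gb Y Z) = (\<lambda>p. on_fields gb (Db X Y) Z p + on_fields gb Y (Db X Z) p)"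
  proof
    fix p
    have "deriv_along X (on_fields gb Y Z) p =
        X p (\<lambda>p. a * g p (Y p) (Z p) + a * (a - 1) * (\<eta> p (Y p) * \<eta> p (Z p)))"
      by (simp add: deriv_along_def on_fields_def[abs_def] gb_def)
    also have "\<dots> = a * X p (\<lambda>p. g p (Y p) (Z p)) +
        a * (a - 1) * (\<eta> p (Y p) * X p (\<lambda>p. \<eta> p (Z p)) + \<eta> p (Z p) * X p (\<lambda>p. \<eta> p (Y p)))"
      by (simp only: tangent_add[OF tangent[OF X]] tangent_scale[OF tangent[OF X]] tangent_mult[OF tangent[OF X]]
          metric_smooth[OF metric Y Z] smooth_fun_mult[OF atlas] smooth_fun_const[OF atlas] eta_smooth Y Z)
    also have "\<dots> = on_fields gb (D X Y) Z p + on_fields gb Y (D X Z) p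
        + a * (a - 1) * (\<eta> p (Y p) * horiz X Z p + \<eta> p (Z p) * horiz X Y p)"
      unfolding lc(7)[OF X Y Z] deriv_eta[OF X Y] deriv_eta[OF X Z]
      by (simp add: on_fields_def gb_def algebra_simps)
    also have "\<dots> = on_fields gb (Db X Y) Z p + on_fields gb Y (Db X Z) p"
    proof -
      have "on_fields gb (Db X Y) Z p = on_fields gb (D X Y) Z p + (b * a\<^sup>2) * (\<eta> p (Z p) * horiz X Y p)"
        by (simp add: on_fields_def Db_def vf_add_def vf_scale_def metric_add_left[OF gb_riemannian]
            metric_scale_left[OF gb_riemannian] tangent lc(1) X Y Z xi closed gb_xi)
      moreover have "on_fields gb Y (Db X Z) p = on_fields gb Y (D X Z) p + (b * a\<^sup>2) * (\<eta> p (Y p) * horiz X Z p)"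
        by (simp add: on_fields_def Db_def vf_add_def vf_scale_def metric_add_right[OF atlas gb_riemannian]
            metric_scale_right[OF atlas gb_riemannian] tangent lc(1) X Y Z xi closed gb_xi
            metric_sym[OF gb_riemannian, of "Y p" p "\<xi> p"])
      moreover have "b * a\<^sup>2 = a * (a - 1)" using a by (simp add: b_def power2_eq_square)
      ultimately show ?thesis by (simp only: distrib_left)
    qed
    finally show "deriv_along X (on_fields gb Y Z) p = on_fields gb (Db X Y) Z p + on_fields gb Y (Db X Z) p" .
  qed
qed

lemma Db_Db:
  assumes X: "vector_field A X" and Y: "vector_field A Y" and Z: "vector_field A Z"
  shows "Db X (Db Y Z) p f = D X (D Y Z) p f
    + b * (X p (horiz Y Z) + horiz X (D Y Z) p) * \<xi> p f
    + b * horiz Y Z p * (X p f - \<eta> p (X p) * \<xi> p f)"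
proof -
  let ?h = "\<lambda>p. b * horiz Y Z p"
  have h: "smooth_fun A ?h" by (intro smooth_fun_mult smooth_fun_const horiz_smooth atlas Y Z)
  have s: "vector_field A (vf_scale ?h \<xi>)" by (intro vector_field_scale h atlas xi)
  note DYZ = lc(1)[OF Y Z]
  have "X p ?h = b * X p (horiz Y Z)" using tangent_scale[OF tangent[OF X] horiz_smooth[OF Y Z]] by simp
  moreover have "horiz X (Db Y Z) p = horiz X (D Y Z) p"
    unfolding Db_def horiz_add_right[OF DYZ s X] horiz_scale_right[OF xi X h]
    by (simp add: horiz_sym[OF X xi] horiz_xi[OF X])
  moreover have "D X (Db Y Z) = vf_add (D X (D Y Z))
      (vf_add (vf_scale (deriv_along X ?h) \<xi>) (vf_scale ?h (vf_diff X (vf_scale (\<lambda>p. \<eta> p (X p)) \<xi>))))"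
    unfolding Db_def lc(3)[OF DYZ s X] lc(5)[OF h X xi] nabla_xi[OF X] by simp
  ultimately show ?thesis
    unfolding Db_def[of X "Db Y Z"]
    by (simp add: vf_add_def vf_scale_def vf_diff_def tv_add_def tv_scale_def tv_diff_def deriv_along_def algebra_simps)
qed

text \<open>The terms quadratic in the correction of the connection vanish, because \<open>horiz\<close> annihilates \<open>\<xi>\<close>; of the
  linear ones, those along \<open>\<xi>\<close> cancel.\<close>

lemma curvature_deformed:
  assumes X: "vector_field A X" and Y: "vector_field A Y" and Z: "vector_field A Z"
  shows "curvature A gb X Y Z p = tv_add (curvature A g X Y Z p)
    (tv_diff (tv_scale (b * horiz Y Z p) (X p)) (tv_scale (b * horiz X Z p) (Y p)))"
proof
  fix f
  have br: "vector_field A (bracket X Y)"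
    unfolding lc(6)[OF X Y] by (intro vector_field_diff atlas lc(1) X Y)
  have hb: "horiz (bracket X Y) Z p = horiz (D X Y) Z p - horiz (D Y X) Z p"
    unfolding lc(6)[OF X Y] by (rule horiz_diff[OF lc(1)[OF X Y] lc(1)[OF Y X] Z])
  have "curvature A gb X Y Z p f = Db X (Db Y Z) p f - Db Y (Db X Z) p f - Db (bracket X Y) Z p f"
    unfolding curvature_eq[OF atlas gb_riemannian Db_levi_civita X Y Z] by (simp add: vf_diff_def tv_diff_def)
  moreover have "curvature A g X Y Z p f = D X (D Y Z) p f - D Y (D X Z) p f - D (bracket X Y) Z p f"
    unfolding curvature_eq[OF atlas metric D X Y Z] by (simp add: vf_diff_def tv_diff_def)
  moreover have "Db (bracket X Y) Z p f = D (bracket X Y) Z p f + b * (horiz (D X Y) Z p - horiz (D Y X) Z p) * \<xi> p f"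
    by (simp add: Db_def vf_add_def vf_scale_def tv_add_def tv_scale_def hb)
  ultimately have "curvature A gb X Y Z p f = curvature A g X Y Z p f
      + b * horiz Y Z p * X p f - b * horiz X Z p * Y p f"
    unfolding Db_Db[OF X Y Z] Db_Db[OF Y X Z] deriv_horiz[OF X Y Z] deriv_horiz[OF Y X Z]
    by (simp add: horiz_sym[OF X Y] algebra_simps)
  then show "curvature A gb X Y Z p f = tv_add (curvature A g X Y Z p)
      (tv_diff (tv_scale (b * horiz Y Z p) (X p)) (tv_scale (b * horiz X Z p) (Y p))) f"
    by (simp add: tv_add_def tv_diff_def tv_scale_def)
qed

end

section \<open>The traced soliton equation\<close>

text \<open>This is the contraction of the right-hand side of the soliton equation in its outer slots with the
  inverse of the deformed metric, \<open>1/a \<Sum> e\<^sub>i \<otimes> e\<^sub>i - (a-1)/a\<^sup>2 \<xi> \<otimes> \<xi>\<close>, written in components.  In a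
  \<open>g\<close>-orthonormal frame \<open>x\<close>, \<open>y\<close>, \<open>z\<close> are the components of \<open>\<xi>\<close> and of the fields \<open>Y\<close>, \<open>Z\<close> in the
  inner slots; \<open>d\<close>, \<open>e\<close>, \<open>h\<close>, \<open>k\<close> are the Hessian values at \<open>(e\<^sub>i, e\<^sub>i)\<close>, \<open>(e\<^sub>i, \<xi>)\<close>, \<open>(e\<^sub>i, Y)\<close>,
  \<open>(e\<^sub>i, Z)\<close>; \<open>l\<close> is the soliton function and \<open>G\<close> the deformed inner product of \<open>Y\<close> and \<open>Z\<close>.\<close>

lemma soliton_trace_sum:
  fixes x y z d e h k :: "nat \<Rightarrow> real"
  assumes a: "a \<noteq> 0"
    and xx: "(\<Sum>i<N. x i * x i) = 1" and xy: "(\<Sum>i<N. x i * y i) = y0" and xz: "(\<Sum>i<N. x i * z i) = z0"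
    and yz: "(\<Sum>i<N. y i * z i) = q" and d: "(\<Sum>i<N. d i) = T" and ex: "(\<Sum>i<N. e i * x i) = Hxx"
    and hz: "(\<Sum>i<N. h i * z i) = H" and ky: "(\<Sum>i<N. k i * y i) = H"
    and hx: "(\<Sum>i<N. h i * x i) = HxY" and kx: "(\<Sum>i<N. k i * x i) = HxZ"
    and G: "G = a * q + a * (a - 1) * (y0 * z0)"
  shows "(\<Sum>i<N. 1 / a * (l * ((a + a * (a - 1) * (x i * x i)) * G
              - (a * z i + a * (a - 1) * (z0 * x i)) * (a * y i + a * (a - 1) * (y0 * x i)))
            - (d i * G + H * (a + a * (a - 1) * (x i * x i))
              - k i * (a * y i + a * (a - 1) * (y0 * x i)) - h i * (a * z i + a * (a - 1) * (z0 * x i))))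
          - (a - 1) / a\<^sup>2 * (x i * (l * (a\<^sup>2 * x i * G - (a * z i + a * (a - 1) * (z0 * x i)) * (a\<^sup>2 * y0))
            - (e i * G + H * (a\<^sup>2 * x i) - k i * (a\<^sup>2 * y0) - HxY * (a * z i + a * (a - 1) * (z0 * x i))))))
    = ((real N - 1) * l - (T / a - (a - 1) / a\<^sup>2 * Hxx)) * G - (real N - 2) * H" (is "sum ?t _ = _")
proof -
  let ?b = "(a - 1) / a\<^sup>2"
  have "?t i = (l * G - H) - l * a * (y i * z i) - l * a * (a - 1) * z0 * (x i * y i) - G / a * d i
      + k i * y i + h i * z i + (a - 1) * z0 * (h i * x i) + ?b * G * (e i * x i)
      - ?b * a * HxY * (x i * z i) - ?b * a * HxY * (a - 1) * z0 * (x i * x i)" for i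
    using a by (simp add: field_simps power2_eq_square)
  then have "sum ?t {..<N} = (\<Sum>i<N. (l * G - H) - l * a * (y i * z i) - l * a * (a - 1) * z0 * (x i * y i) - G / a * d i
      + k i * y i + h i * z i + (a - 1) * z0 * (h i * x i) + ?b * G * (e i * x i)
      - ?b * a * HxY * (x i * z i) - ?b * a * HxY * (a - 1) * z0 * (x i * x i))"
    by (rule sum.cong[OF refl])
  also have "\<dots> = real N * (l * G - H) - l * a * q - l * a * (a - 1) * z0 * y0 - G / a * T
      + H + H + (a - 1) * z0 * HxY + ?b * G * Hxx - ?b * a * HxY * z0 - ?b * a * HxY * (a - 1) * z0 * 1"
    by (simp only: sum.distrib sum_subtractf sum_constant card_lessThan sum_distrib_left[symmetric] xx xy xz yz d ex hz ky hx kx)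
      (simp add: algebra_simps)
  also have "\<dots> = ((real N - 1) * l - (T / a - ?b * Hxx)) * G - (real N - 2) * H"
    using a by (simp add: G field_simps power2_eq_square)
  finally show ?thesis .
qed

section \<open>Gradient solitons of the deformed metric\<close>

locale gradient_soliton = deformed_kenmotsu A \<phi> \<xi> \<eta> g D a
  for A :: "('p::{t2_space,second_countable_topology}, 'e::euclidean_space) atlas"
    and \<phi> \<xi> \<eta> g D a +
  fixes f l :: "'p \<Rightarrow> real"
  assumes f: "smooth_fun A f" and soliton: "almost_riemann_soliton A gb (gradient A gb f) l"
begin

abbreviation "V \<equiv> gradient A gb f"

text \<open>This is the deformed Hessian of \<open>f\<close>, see \<open>Hb_deriv\<close>.  In the form chosen here it is evidently
  tensorial in \<open>Y\<close>.\<close>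

definition Hb :: "'p tensor2" where
  "Hb X Y p = gb p (Db X V p) (Y p)"

lemmas lcb = levi_civitaD[OF Db_levi_civita]

lemma V: "vector_field A V"
  using soliton by (simp add: almost_riemann_soliton_def)

lemma gb_V: "u \<in> tangent_space A p \<Longrightarrow> gb p (V p) u = u f"
  by (rule gradient_metric[OF atlas gb_riemannian f])

lemma Hb_deriv:
  assumes X: "vector_field A X" and Y: "vector_field A Y"
  shows "Hb X Y p = X p (deriv_along Y f) - Db X Y p f"
proof -
  have "(\<lambda>p. gb p (V p) (Y p)) = deriv_along Y f" by (simp add: gb_V tangent[OF Y] deriv_along_def)
  then show ?thesis
    using lcb(7)[OF X V Y, of p] gb_V[OF tangent[OF Db_closed[OF X Y]], of p] by (simp add: Hb_def)
qed

lemma Hb_sym: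
  assumes X: "vector_field A X" and Y: "vector_field A Y"
  shows "Hb X Y p = Hb Y X p"
proof -
  have "bracket X Y p f = Db X Y p f - Db Y X p f"
    unfolding lcb(6)[OF X Y] by (simp add: vf_diff_def tv_diff_def)
  then show ?thesis by (simp add: Hb_deriv X Y bracket_def)
qed

lemma hessian_eq:
  assumes X: "vector_field A X" and Y: "vector_field A Y"
  shows "hessian A g f X Y p = Hb X Y p + b * deriv_along \<xi> f p * horiz X Y p"
  unfolding hessian_def levi_civita_eq[OF atlas metric D X Y] Hb_deriv[OF X Y]
  by (simp add: Db_def deriv_along_def vf_add_def vf_scale_def tv_add_def tv_scale_def)

text \<open>Compatibility and vanishing torsion turn the Lie derivative into the symmetrised covariant derivative of
  the gradient.\<close>

lemma lie_deriv_eq: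
  assumes X: "vector_field A X" and Y: "vector_field A Y"
  shows "lie_deriv_metric V gb X Y p = 2 * Hb X Y p"
proof -
  have *: "gb p (bracket V X p) (Y p) = gb p (Db V X p) (Y p) - Hb X Y p"
    if X: "vector_field A X" and Y: "vector_field A Y" for X Y
    unfolding lcb(6)[OF V X] Hb_def
    by (simp add: vf_diff_def metric_diff_left[OF atlas gb_riemannian] tangent Db_closed X Y V)
  have "gb p (X p) (bracket V Y p) = gb p (X p) (Db V Y p) - Hb X Y p"
    using *[OF Y X] lcb(6)[OF V Y]
    by (simp add: metric_sym[OF gb_riemannian, of "X p"] tangent Db_closed vector_field_diff[OF atlas] X Y V Hb_sym)
  then show ?thesis
    using lcb(7)[OF V X Y, of p] *[OF X Y]
    by (simp add: lie_deriv_metric_def deriv_along_def on_fields_def[abs_def])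
qed

lemma soliton_curvature:
  assumes X: "vector_field A X" and Y: "vector_field A Y" and Z: "vector_field A Z" and W: "vector_field A W"
  shows "gb p (curvature A gb X Y Z p) (W p) =
    l p * (gb p (X p) (W p) * gb p (Y p) (Z p) - gb p (X p) (Z p) * gb p (Y p) (W p))
    - (Hb X W p * gb p (Y p) (Z p) + Hb Y Z p * gb p (X p) (W p)
      - Hb X Z p * gb p (Y p) (W p) - Hb Y W p * gb p (X p) (Z p))"
proof -
  have "1 / 2 * kulkarni_nomizu (lie_deriv_metric V gb) (on_fields gb) X Y Z W p + riemann A gb X Y Z W p
      = l p / 2 * kulkarni_nomizu (on_fields gb) (on_fields gb) X Y Z W p"
    using soliton X Y Z W unfolding almost_riemann_soliton_def by blast
  then show ?thesis
    by (simp add: kulkarni_nomizu_def lie_deriv_eq X Y Z W riemann_def on_fields_def field_simps)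
qed

lemma Hb_expansion:
  assumes E: "orthonormal_at A g p E" and X: "vector_field A X" and Y: "vector_field A Y"
  shows "(\<Sum>i<DIM('e). Hb (E i) X p * g p (Y p) (E i p)) = Hb Y X p"
proof -
  have Ei: "vector_field A (E i)" if "i < DIM('e)" for i using E that by (simp add: orthonormal_at_def)
  have t: "Db X V p \<in> tangent_space A p" by (rule tangent[OF Db_closed[OF X V]])
  have "gb p (Db X V p) (Y p) = (\<Sum>i<DIM('e). g p (Y p) (E i p) * gb p (Db X V p) (E i p))"
    by (rule orthonormal_at_linear_expansion[OF atlas metric E tangent[OF Y]])
      (simp_all add: metric_add_right[OF atlas gb_riemannian] metric_scale_right[OF atlas gb_riemannian] t)
  also have "\<dots> = (\<Sum>i<DIM('e). Hb (E i) X p * g p (Y p) (E i p))"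
    by (rule sum.cong) (auto simp: Hb_sym[OF Ei X] Hb_def[of X])
  finally show ?thesis using Hb_sym[OF X Y] by (simp add: Hb_def)
qed

lemma metric_expansion:
  assumes E: "orthonormal_at A g p E" and u: "u \<in> tangent_space A p" and v: "v \<in> tangent_space A p"
  shows "(\<Sum>i<DIM('e). g p u (E i p) * g p v (E i p)) = g p u v"
proof -
  have "g p v u = (\<Sum>i<DIM('e). g p u (E i p) * g p v (E i p))"
    by (rule orthonormal_at_linear_expansion[OF atlas metric E u])
      (simp_all add: metric_add_right[OF atlas metric] metric_scale_right[OF atlas metric] v)
  then show ?thesis by (simp add: metric_sym[OF metric u v])
qed

text \<open>The left-hand side is the Ricci curvature of the deformed metric, by \<open>curvature_deformed\<close>.  The number
  \<open>\<mu>\<close> collects the soliton function and the deformed Laplacian of \<open>f\<close>; it is left unspecified, because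
  evaluating the equation at \<open>Y = Z = \<xi>\<close> determines it.\<close>

lemma ricci_trace:
  assumes E: "orthonormal_at A g p E"
  obtains \<mu> where "\<And>Y Z. vector_field A Y \<Longrightarrow> vector_field A Z \<Longrightarrow>
    (\<Sum>i<DIM('e). g p (curvature A g (E i) Y Z p) (E i p)) + b * (real DIM('e) - 1) * horiz Y Z p
    = \<mu> * gb p (Y p) (Z p) - (real DIM('e) - 2) * Hb Y Z p"
proof -
  let ?N = "DIM('e)"
  have Ei: "vector_field A (E i)" if "i < ?N" for i using E that by (simp add: orthonormal_at_def)
  have Eij: "g p (E i p) (E i p) = 1" if "i < ?N" for i using E that by (simp add: orthonormal_at_def)
  define x where "x i = \<eta> p (E i p)" for i
  have x: "g p (\<xi> p) (E i p) = x i" if "i < ?N" for i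
    using eta[OF tangent[OF Ei[OF that]]] by (simp add: x_def)
  define T where "T = (\<Sum>i<?N. Hb (E i) (E i) p)"
  have "(\<Sum>i<?N. g p (curvature A g (E i) Y Z p) (E i p)) + b * (real ?N - 1) * horiz Y Z p
      = ((real ?N - 1) * l p - (T / a - (a - 1) / a\<^sup>2 * Hb \<xi> \<xi> p)) * gb p (Y p) (Z p) - (real ?N - 2) * Hb Y Z p"
    if Y: "vector_field A Y" and Z: "vector_field A Z" for Y Z
  proof -
    let ?eY = "\<eta> p (Y p)" and ?eZ = "\<eta> p (Z p)"
    let ?y = "\<lambda>i. g p (Y p) (E i p)" and ?z = "\<lambda>i. g p (Z p) (E i p)"
    let ?G = "gb p (Y p) (Z p)" and ?H = "Hb Y Z p"
    have gbEE: "gb p (E i p) (E i p) = a + a * (a - 1) * (x i * x i)"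
      and gbEZ: "gb p (E i p) (Z p) = a * ?z i + a * (a - 1) * (?eZ * x i)"
      and gbYE: "gb p (Y p) (E i p) = a * ?y i + a * (a - 1) * (?eY * x i)"
      and gbEx: "gb p (E i p) (\<xi> p) = a\<^sup>2 * x i"
      if "i < ?N" for i
      using Eij[OF that] gb_xi[OF tangent[OF Ei[OF that]]]
      by (simp_all add: gb_def x_def metric_sym[OF metric tangent[OF Ei[OF that]] tangent[OF Z]]
          metric_sym[OF gb_riemannian tangent[OF Ei[OF that]] xi_tangent, unfolded gb_def])
    have gbYx: "gb p (Y p) (\<xi> p) = a\<^sup>2 * ?eY"
      using gb_xi[OF tangent[OF Y]] by (simp add: metric_sym[OF gb_riemannian tangent[OF Y] xi_tangent])
    have contribution: "g p (curvature A g (E i) Y Z p) (E i p) + b * (horiz Y Z p - (?z i - ?eZ * x i) * ?y i) =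
        1 / a * (l p * ((a + a * (a - 1) * (x i * x i)) * ?G
              - (a * ?z i + a * (a - 1) * (?eZ * x i)) * (a * ?y i + a * (a - 1) * (?eY * x i)))
            - (Hb (E i) (E i) p * ?G + ?H * (a + a * (a - 1) * (x i * x i))
              - Hb (E i) Z p * (a * ?y i + a * (a - 1) * (?eY * x i)) - Hb (E i) Y p * (a * ?z i + a * (a - 1) * (?eZ * x i))))
          - (a - 1) / a\<^sup>2 * (x i * (l p * (a\<^sup>2 * x i * ?G - (a * ?z i + a * (a - 1) * (?eZ * x i)) * (a\<^sup>2 * ?eY))
            - (Hb (E i) \<xi> p * ?G + ?H * (a\<^sup>2 * x i) - Hb (E i) Z p * (a\<^sup>2 * ?eY) - Hb \<xi> Y p * (a * ?z i + a * (a - 1) * (?eZ * x i)))))"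
      if i: "i < ?N" for i
    proof -
      note tE = tangent[OF Ei[OF i], of p]
      let ?u = "curvature A gb (E i) Y Z p" and ?w = "curvature A g (E i) Y Z p"
      have tu: "?u \<in> tangent_space A p" "?w \<in> tangent_space A p"
        by (intro tangent vector_field_curvature[OF atlas gb_riemannian Db_levi_civita]
            vector_field_curvature[OF atlas metric D] Ei[OF i] Y Z)+
      have "g p ?u (E i p) = g p ?w (E i p) + b * (horiz Y Z p * 1 - horiz (E i) Z p * ?y i)"
        unfolding curvature_deformed[OF Ei[OF i] Y Z]
        by (simp add: metric_add_left[OF metric] metric_diff_left[OF atlas metric] metric_scale_left[OF metric]
            closed tu tE tangent[OF Y] Eij[OF i] algebra_simps)
      moreover have "horiz (E i) Z p = ?z i - ?eZ * x i"
        by (simp add: horiz_def x_def metric_sym[OF metric tE tangent[OF Z]])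
      \<comment> \<open>lowering with \<open>g\<close> in terms of lowering with \<open>gb\<close>, so that the soliton equation applies\<close>
      moreover have "g p ?u (E i p) = 1 / a * gb p ?u (E i p) - (a - 1) / a\<^sup>2 * (x i * gb p ?u (\<xi> p))"
      proof -
        have "gb p ?u (\<xi> p) = a\<^sup>2 * \<eta> p ?u"
          by (simp add: metric_sym[OF gb_riemannian tu(1) xi_tangent] gb_xi tu)
        then show ?thesis using a by (simp add: gb_def x_def field_simps power2_eq_square)
      qed
      ultimately show ?thesis
        unfolding soliton_curvature[OF Ei[OF i] Y Z Ei[OF i]] soliton_curvature[OF Ei[OF i] Y Z xi]
          gbEE[OF i] gbEZ[OF i] gbYE[OF i] gbEx[OF i] gbYx Hb_sym[OF Y Ei[OF i]] Hb_sym[OF Y xi]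
        by simp
    qed
    have xx: "(\<Sum>i<?N. x i * x i) = 1"
      using metric_expansion[OF E xi_tangent xi_tangent] eta[OF xi_tangent, of p]
      by (simp add: x eta_xi cong: sum.cong_simp)
    have xy: "(\<Sum>i<?N. x i * g p (X p) (E i p)) = \<eta> p (X p)" if "vector_field A X" for X
      using metric_expansion[OF E xi_tangent tangent[OF that]] eta[OF tangent[OF that]]
      by (simp add: x cong: sum.cong_simp)
    have yz: "(\<Sum>i<?N. ?y i * ?z i) = g p (Y p) (Z p)"
      by (rule metric_expansion[OF E tangent[OF Y] tangent[OF Z]])
    have Hx: "(\<Sum>i<?N. Hb (E i) X p * x i) = Hb \<xi> X p" if "vector_field A X" for X
      using Hb_expansion[OF E that xi] by (simp add: x cong: sum.cong_simp)
    have "(\<Sum>i<?N. horiz Y Z p - (?z i - ?eZ * x i) * ?y i) =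
        real ?N * horiz Y Z p - ((\<Sum>i<?N. ?y i * ?z i) - ?eZ * (\<Sum>i<?N. x i * ?y i))"
      by (simp add: sum_subtractf sum.distrib sum_distrib_left algebra_simps)
    then have hs: "(\<Sum>i<?N. horiz Y Z p - (?z i - ?eZ * x i) * ?y i) = (real ?N - 1) * horiz Y Z p"
      unfolding yz xy[OF Y] by (simp add: horiz_def algebra_simps)
    have "(\<Sum>i<?N. g p (curvature A g (E i) Y Z p) (E i p)) + b * (real ?N - 1) * horiz Y Z p =
        (\<Sum>i<?N. g p (curvature A g (E i) Y Z p) (E i p) + b * (horiz Y Z p - (?z i - ?eZ * x i) * ?y i))"
      by (simp add: sum.distrib sum_distrib_left[symmetric] hs)
    also have "\<dots> = ((real ?N - 1) * l p - (T / a - (a - 1) / a\<^sup>2 * Hb \<xi> \<xi> p)) * ?G - (real ?N - 2) * ?H"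
      using a
      by (subst sum.cong[OF refl contribution], simp,
          intro soliton_trace_sum[OF _ xx xy[OF Y] xy[OF Z] yz T_def[symmetric] Hx[OF xi] _ _ Hx[OF Y] Hx[OF Z]])
        (auto simp: Hb_expansion[OF E] Y Z gb_def Hb_sym[OF Z Y])
    finally show ?thesis .
  qed
  then show ?thesis using that by blast
qed

end

section \<open>The norm of the Ricci tensor\<close>

text \<open>A symmetric shift of a multiple of a matrix by the identity and by the projection onto a unit vector \<open>x\<close>
  changes its norm only by terms in its trace and its value at \<open>(x, x)\<close>.\<close>

lemma sum_square_rank_one_shift:
  fixes r h :: "nat \<Rightarrow> nat \<Rightarrow> real" and x :: "nat \<Rightarrow> real"
  assumes r: "\<And>i j. i < N \<Longrightarrow> j < N \<Longrightarrow> r i j = - m * h i j + \<alpha> * (if i = j then 1 else 0) + \<gamma> * (x i * x j)"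
    and xx: "(\<Sum>i<N. x i * x i) = 1" and T: "(\<Sum>i<N. h i i) = T"
    and k: "(\<Sum>i<N. \<Sum>j<N. h i j * (x i * x j)) = k"
  shows "(\<Sum>i<N. \<Sum>j<N. (r i j)\<^sup>2) =
      m\<^sup>2 * (\<Sum>i<N. \<Sum>j<N. (h i j)\<^sup>2) + \<alpha>\<^sup>2 * real N + \<gamma>\<^sup>2 - 2 * m * \<alpha> * T - 2 * m * \<gamma> * k + 2 * \<alpha> * \<gamma>"
    and "(\<Sum>i<N. r i i) = - m * T + \<alpha> * real N + \<gamma>"
proof -
  let ?d = "\<lambda>i j. if i = j then 1 else 0 :: real"
  have 1: "(\<Sum>i<N. \<Sum>j<N. ?d i j) = real N" by simp
  have 2: "(\<Sum>i<N. \<Sum>j<N. h i j * ?d i j) = T" by (simp add: if_distrib T cong: if_cong sum.cong_simp)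
  have 3: "(\<Sum>i<N. \<Sum>j<N. ?d i j * (x i * x j)) = 1"
    by (simp add: if_distrib[of "\<lambda>t. t * _"] xx cong: if_cong sum.cong_simp)
  have "(\<Sum>i<N. \<Sum>j<N. (r i j)\<^sup>2) = (\<Sum>i<N. \<Sum>j<N. m\<^sup>2 * (h i j)\<^sup>2 + \<alpha>\<^sup>2 * ?d i j + \<gamma>\<^sup>2 * ((x i * x i) * (x j * x j))
      - 2 * m * \<alpha> * (h i j * ?d i j) - 2 * m * \<gamma> * (h i j * (x i * x j)) + 2 * \<alpha> * \<gamma> * (?d i j * (x i * x j)))"
    by (intro sum.cong refl) (auto simp: r power2_eq_square algebra_simps)
  also have "\<dots> = m\<^sup>2 * (\<Sum>i<N. \<Sum>j<N. (h i j)\<^sup>2) + \<alpha>\<^sup>2 * real N + \<gamma>\<^sup>2 * 1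
      - 2 * m * \<alpha> * T - 2 * m * \<gamma> * k + 2 * \<alpha> * \<gamma> * 1"
    by (simp only: sum.distrib sum_subtractf sum_distrib_left[symmetric] 1 2 3 k xx mult_1_right)
  finally show "(\<Sum>i<N. \<Sum>j<N. (r i j)\<^sup>2) =
      m\<^sup>2 * (\<Sum>i<N. \<Sum>j<N. (h i j)\<^sup>2) + \<alpha>\<^sup>2 * real N + \<gamma>\<^sup>2 - 2 * m * \<alpha> * T - 2 * m * \<gamma> * k + 2 * \<alpha> * \<gamma>"
    by simp
  have "(\<Sum>i<N. r i i) = (\<Sum>i<N. (- m) * h i i + \<alpha> + \<gamma> * (x i * x i))"
    by (intro sum.cong refl) (simp add: r)
  also have "\<dots> = - m * T + real N * \<alpha> + \<gamma> * 1"
    by (simp only: sum.distrib sum_distrib_left[symmetric] T xx) simp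
  finally show "(\<Sum>i<N. r i i) = - m * T + \<alpha> * real N + \<gamma>" by simp
qed

text \<open>Here \<open>h\<close>, \<open>k\<close>, \<open>T\<close>, \<open>Q\<close>, \<open>R\<close>, \<open>S\<close> stand for \<open>\<xi>(f)\<close>, \<open>\<xi>(\<xi>(f))\<close>, the Laplacian of \<open>f\<close>, the squared
  norms of the Hessian and of the Ricci tensor, and the scalar curvature.  Substituting
  \<open>\<mu>\<close>, \<open>\<alpha>\<close>, \<open>\<gamma>\<close> makes \<open>2n + 1\<close> times the difference of the two sides the square of
  \<open>S + 2n (2n + 1) (a - 1) / a\<close>, identically in the remaining variables.\<close>

lemma ricci_norm_inequality:
  fixes n a h k T Q R S \<mu> \<alpha> \<gamma> :: real
  assumes n: "n \<ge> 1" and a: "a > 0"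
    and \<mu>: "\<mu> * a\<^sup>2 = (2 * n - 1) * k - 2 * n"
    and \<alpha>: "\<alpha> = a * \<mu> + (2 * n - 1) * ((a - 1) / a) * h - 2 * n * ((a - 1) / a)"
    and \<gamma>: "\<gamma> = \<mu> * a\<^sup>2 - \<alpha>"
    and R: "R = (2 * n - 1)\<^sup>2 * Q + \<alpha>\<^sup>2 * (2 * n + 1) + \<gamma>\<^sup>2 - 2 * (2 * n - 1) * \<alpha> * T
      - 2 * (2 * n - 1) * \<gamma> * k + 2 * \<alpha> * \<gamma>"
    and S: "S = - (2 * n - 1) * T + \<alpha> * (2 * n + 1) + \<gamma>"
  shows "R \<ge> (2 * n - 1)\<^sup>2 * Q - 4 * n * ((a - 1) / a) * S - 4 * n\<^sup>2 * (2 * n + 1) * ((a - 1) / a)\<^sup>2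
      - (2 * n - 1)\<^sup>2 / (2 * n + 1) * T\<^sup>2
      - 2 * (2 * n - 1)\<^sup>2 / (2 * n + 1) * ((a - 1) / a) * (h - k) * T
      + 2 * n * (2 * n - 1)\<^sup>2 / (2 * n + 1) * ((a - 1) / a)\<^sup>2 * h\<^sup>2
      - 2 * (2 * n - 1)\<^sup>2 * (n + n * a + a) * (a - 1) / ((2 * n + 1) * a\<^sup>2) * k\<^sup>2
      + 2 * (2 * n - 1)\<^sup>2 * (2 * n + a) * (a - 1) / ((2 * n + 1) * a\<^sup>2) * (h * k)" (is "R \<ge> ?B")
proof -
  \<comment> \<open>in terms of \<open>1 / a\<close> all expressions are polynomial\<close>
  define c where "c = 1 / a"
  define N where "N = 2 * n + 1"
  have N: "N > 0" using n by (simp add: N_def)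
  have b: "(a - 1) / a = 1 - c" using a by (simp add: c_def field_simps)
  have e1: "2 * (2 * n - 1)\<^sup>2 * (n + n * a + a) * (a - 1) / (N * a\<^sup>2) = 2 * (2 * n - 1)\<^sup>2 * (n * c + n + 1) * (1 - c) / N"
    using a N by (simp add: c_def field_simps power2_eq_square)
  have e2: "2 * (2 * n - 1)\<^sup>2 * (2 * n + a) * (a - 1) / (N * a\<^sup>2) = 2 * (2 * n - 1)\<^sup>2 * (2 * n * c + 1) * (1 - c) / N"
    using a N by (simp add: c_def field_simps power2_eq_square)
  have "a * \<mu> = c * (\<mu> * a\<^sup>2)" using a by (simp add: c_def power2_eq_square)
  then have \<alpha>': "\<alpha> = c * ((2 * n - 1) * k - 2 * n) + (2 * n - 1) * (1 - c) * h - 2 * n * (1 - c)"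
    unfolding \<alpha> \<mu> b by simp
  have \<gamma>': "\<gamma> = (2 * n - 1) * k - 2 * n - \<alpha>" unfolding \<gamma> \<mu> by simp
  have "N * ?B = N * ((2 * n - 1)\<^sup>2 * Q - 4 * n * (1 - c) * S - 4 * n\<^sup>2 * N * (1 - c)\<^sup>2)
      - (2 * n - 1)\<^sup>2 * T\<^sup>2 - 2 * (2 * n - 1)\<^sup>2 * (1 - c) * (h - k) * T
      + 2 * n * (2 * n - 1)\<^sup>2 * (1 - c)\<^sup>2 * h\<^sup>2
      - 2 * (2 * n - 1)\<^sup>2 * (n * c + n + 1) * (1 - c) * k\<^sup>2
      + 2 * (2 * n - 1)\<^sup>2 * (2 * n * c + 1) * (1 - c) * (h * k)"
    unfolding N_def[symmetric] b e1 e2 using N by (simp add: field_simps)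
  moreover have "N * R - (N * ((2 * n - 1)\<^sup>2 * Q - 4 * n * (1 - c) * S - 4 * n\<^sup>2 * N * (1 - c)\<^sup>2)
      - (2 * n - 1)\<^sup>2 * T\<^sup>2 - 2 * (2 * n - 1)\<^sup>2 * (1 - c) * (h - k) * T
      + 2 * n * (2 * n - 1)\<^sup>2 * (1 - c)\<^sup>2 * h\<^sup>2
      - 2 * (2 * n - 1)\<^sup>2 * (n * c + n + 1) * (1 - c) * k\<^sup>2
      + 2 * (2 * n - 1)\<^sup>2 * (2 * n * c + 1) * (1 - c) * (h * k)) = (S + 2 * n * (1 - c) * N)\<^sup>2"
    unfolding R S \<gamma>' \<alpha>' N_def by algebra
  ultimately have "N * R \<ge> N * ?B" by (metis diff_ge_0_iff_ge zero_le_power2)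
  then show ?thesis using N by simp
qed

context gradient_soliton
begin

lemma ricci_along_xi:
  assumes E: "orthonormal_at A g p E"
  shows "(\<Sum>i<DIM('e). g p (curvature A g (E i) \<xi> \<xi> p) (E i p)) = 1 - real DIM('e)"
proof -
  have "g p (curvature A g (E i) \<xi> \<xi> p) (E i p) = g p (\<xi> p) (E i p) * g p (\<xi> p) (E i p) - 1"
    if "i < DIM('e)" for i
  proof -
    have Ei: "vector_field A (E i)" and Eii: "g p (E i p) (E i p) = 1"
      using E that by (auto simp: orthonormal_at_def)
    show ?thesis
      unfolding curvature_xi[OF Ei xi]
      by (simp add: metric_diff_left[OF atlas metric] metric_scale_left[OF metric] closed
          tangent[OF Ei] xi_tangent eta eta_xi Eii)
  qed
  then have "(\<Sum>i<DIM('e). g p (curvature A g (E i) \<xi> \<xi> p) (E i p)) =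
      (\<Sum>i<DIM('e). g p (\<xi> p) (E i p) * g p (\<xi> p) (E i p) - 1)" by simp
  also have "\<dots> = 1 - real DIM('e)"
    using metric_expansion[OF E xi_tangent xi_tangent] eta[OF xi_tangent, of p]
    by (simp add: sum_subtractf eta_xi)
  finally show ?thesis .
qed

lemma Hb_xi_xi: "Hb \<xi> \<xi> p = deriv_along \<xi> (deriv_along \<xi> f) p"
proof -
  have "Db \<xi> \<xi> p f = 0"
    by (simp add: Db_def nabla_xi[OF xi] horiz_xi[OF xi] vf_add_def vf_scale_def vf_diff_def
        tv_add_def tv_scale_def tv_diff_def eta_xi)
  then show ?thesis by (simp add: Hb_deriv[OF xi xi] deriv_along_def)
qed

lemma ricci_norm_bound:
  assumes dim: "DIM('e) = 2 * n + 1" and n: "n \<ge> 1"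
  shows "(hs_norm A g (ricci A g) p)\<^sup>2 \<ge>
      (2 * real n - 1)\<^sup>2 * (hs_norm A g (hessian A g f) p)\<^sup>2
      - 4 * real n * ((a - 1) / a) * scalar_curv A g p
      - 4 * (real n)\<^sup>2 * (2 * real n + 1) * ((a - 1) / a)\<^sup>2
      - (2 * real n - 1)\<^sup>2 / (2 * real n + 1) * (laplacian A g f p)\<^sup>2
      - 2 * (2 * real n - 1)\<^sup>2 / (2 * real n + 1) * ((a - 1) / a)
          * (deriv_along \<xi> f p - deriv_along \<xi> (deriv_along \<xi> f) p) * laplacian A g f p
      + 2 * real n * (2 * real n - 1)\<^sup>2 / (2 * real n + 1) * ((a - 1) / a)\<^sup>2
          * (deriv_along \<xi> f p)\<^sup>2
      - 2 * (2 * real n - 1)\<^sup>2 * (real n + real n * a + a) * (a - 1) / ((2 * real n + 1) * a\<^sup>2)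
          * (deriv_along \<xi> (deriv_along \<xi> f) p)\<^sup>2
      + 2 * (2 * real n - 1)\<^sup>2 * (2 * real n + a) * (a - 1) / ((2 * real n + 1) * a\<^sup>2)
          * (deriv_along \<xi> f p * deriv_along \<xi> (deriv_along \<xi> f) p)"
proof -
  define E where "E = frame_at A g p"
  have E: "orthonormal_at A g p E"
    using someI_ex[OF orthonormal_at_exists[OF atlas metric, of p]] by (simp add: E_def frame_at_def)
  have Ei: "vector_field A (E i)" if "i < DIM('e)" for i
    using E that by (simp add: orthonormal_at_def)
  have Eij: "g p (E i p) (E j p) = (if i = j then 1 else 0)" if "i < DIM('e)" "j < DIM('e)" for i j
    using E that by (simp add: orthonormal_at_def)
  define x where "x i = \<eta> p (E i p)" for i
  have x: "g p (\<xi> p) (E i p) = x i" if "i < DIM('e)" for i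
    using eta[OF tangent[OF Ei[OF that]]] by (simp add: x_def)
  have horizE: "horiz (E i) (E j) p = (if i = j then 1 else 0) - x i * x j" if "i < DIM('e)" "j < DIM('e)" for i j
    using that by (simp add: horiz_def Eij x_def)
  define h k where "h = deriv_along \<xi> f p" and "k = deriv_along \<xi> (deriv_along \<xi> f) p"
  obtain \<mu> where trace: "\<And>Y Z. vector_field A Y \<Longrightarrow> vector_field A Z \<Longrightarrow>
      (\<Sum>i<DIM('e). g p (curvature A g (E i) Y Z p) (E i p)) + b * (real DIM('e) - 1) * horiz Y Z p
      = \<mu> * gb p (Y p) (Z p) - (real DIM('e) - 2) * Hb Y Z p"
    using ricci_trace[OF E] by blast
  have \<mu>: "\<mu> * a\<^sup>2 = (2 * real n - 1) * k - 2 * real n"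
    using trace[OF xi xi] unfolding ricci_along_xi[OF E]
    by (simp add: horiz_xi[OF xi] gb_xi[OF xi_tangent] eta_xi Hb_xi_xi k_def dim algebra_simps)
  define \<alpha> where "\<alpha> = a * \<mu> + (2 * real n - 1) * ((a - 1) / a) * h - 2 * real n * ((a - 1) / a)"
  define \<gamma> where "\<gamma> = \<mu> * a\<^sup>2 - \<alpha>"
  have ricci_sum: "ricci A g Y Z p = (\<Sum>i<DIM('e). g p (curvature A g (E i) Y Z p) (E i p))" for Y Z
    by (simp add: ricci_def metric_trace_def riemann_def on_fields_def E_def)
  have ricci: "ricci A g (E i) (E j) p = - (2 * real n - 1) * hessian A g f (E i) (E j) p
      + \<alpha> * (if i = j then 1 else 0) + \<gamma> * (x i * x j)" if i: "i < DIM('e)" and j: "j < DIM('e)" for i j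
  proof -
    have r: "ricci A g (E i) (E j) p = \<mu> * gb p (E i p) (E j p) - (2 * real n - 1) * Hb (E i) (E j) p
        - b * (2 * real n) * horiz (E i) (E j) p"
      using trace[OF Ei[OF i] Ei[OF j]] by (simp add: ricci_sum dim algebra_simps)
    have gbE: "gb p (E i p) (E j p) = a * (if i = j then 1 else 0) + a * (a - 1) * (x i * x j)"
      by (simp add: gb_def Eij[OF i j] x_def)
    have hess: "hessian A g f (E i) (E j) p = Hb (E i) (E j) p + b * h * horiz (E i) (E j) p"
      by (simp add: hessian_eq[OF Ei[OF i] Ei[OF j]] h_def)
    show ?thesis
      unfolding r gbE hess horizE[OF i j] \<gamma>_def \<alpha>_def b_def[symmetric]
      by (simp add: power2_eq_square algebra_simps)
  qed
  have xx: "(\<Sum>i<DIM('e). x i * x i) = 1"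
    using metric_expansion[OF E xi_tangent xi_tangent] eta[OF xi_tangent, of p]
    by (simp add: x eta_xi cong: sum.cong_simp)
  have Hx: "(\<Sum>i<DIM('e). Hb (E i) X p * x i) = Hb \<xi> X p" if "vector_field A X" for X
    using Hb_expansion[OF E that xi] by (simp add: x cong: sum.cong_simp)
  have kk: "(\<Sum>i<DIM('e). \<Sum>j<DIM('e). hessian A g f (E i) (E j) p * (x i * x j)) = k"
  proof -
    have "(\<Sum>i<DIM('e). \<Sum>j<DIM('e). hessian A g f (E i) (E j) p * (x i * x j)) =
        (\<Sum>i<DIM('e). Hb (E i) \<xi> p * x i + b * h * 0)"
    proof (rule sum.cong[OF refl])
      fix i assume "i \<in> {..<DIM('e)}"
      then have i: "i < DIM('e)" by simp
      have "(\<Sum>j<DIM('e). hessian A g f (E i) (E j) p * (x i * x j)) =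
          (\<Sum>j<DIM('e). x i * (Hb (E j) (E i) p * x j) + b * h * x i * ((if i = j then x i else 0) - x i * (x j * x j)))"
        using i by (intro sum.cong refl)
          (auto simp: hessian_eq Ei horizE h_def Hb_sym[of "E i"] algebra_simps)
      also have "\<dots> = x i * Hb \<xi> (E i) p + b * h * x i * (x i - x i * 1)"
        using i by (simp add: sum.distrib sum_distrib_left[symmetric] sum_subtractf Hx[OF Ei] xx)
      finally show "(\<Sum>j<DIM('e). hessian A g f (E i) (E j) p * (x i * x j)) = Hb (E i) \<xi> p * x i + b * h * 0"
        using Hb_sym[OF xi Ei[OF i]] by simp
    qed
    then show ?thesis by (simp add: Hx[OF xi] Hb_xi_xi k_def)
  qed
  have T: "(\<Sum>i<DIM('e). hessian A g f (E i) (E i) p) = laplacian A g f p"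
    by (simp add: laplacian_def metric_trace_def E_def)
  note norms = sum_square_rank_one_shift[OF ricci xx T kk]
  have sq: "(hs_norm A g B p)\<^sup>2 = (\<Sum>i<DIM('e). \<Sum>j<DIM('e). (B (E i) (E j) p)\<^sup>2)" for B
    unfolding hs_norm_def E_def by (intro real_sqrt_pow2 sum_nonneg) auto
  have scal: "scalar_curv A g p = (\<Sum>i<DIM('e). ricci A g (E i) (E i) p)"
    by (simp add: scalar_curv_def metric_trace_def E_def)
  have n': "real n \<ge> 1" using n by simp
  have N: "real DIM('e) = 2 * real n + 1" by (simp add: dim)
  show ?thesis
    unfolding h_def[symmetric] k_def[symmetric]
    by (rule ricci_norm_inequality[OF n' a \<mu> \<alpha>_def \<gamma>_def])
      (use norms in \<open>simp_all only: sq scal N\<close>)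
qed

end

theorem proposition3p12:
  fixes A :: "('p::{t2_space,second_countable_topology}, 'e::euclidean_space) atlas"
    and \<phi> \<phi>b :: "'p endo" and \<xi> \<xi>b V :: "'p vfield" and \<eta> \<eta>b :: "'p oneform"
    and g gb :: "'p metric"
    and n :: nat and a :: real and f lamb :: "'p \<Rightarrow> real" and p :: 'p
  assumes n: "n \<ge> 1" and dim: "DIM('e) = 2 * n + 1"
    and kenmotsu: "kenmotsu A \<phi> \<xi> \<eta> g"
    and a: "a > 0"
    and deformed: "(\<phi>b, \<xi>b, \<eta>b, gb) = D_homothetic a \<phi> \<xi> \<eta> g"
    and f: "smooth_fun A f"
    and V: "V = gradient A gb f"
    and soliton: "almost_riemann_soliton A gb V lamb"
  shows "(hs_norm A g (ricci A g) p)\<^sup>2 \<ge>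
      (2 * real n - 1)\<^sup>2 * (hs_norm A g (hessian A g f) p)\<^sup>2
      - 4 * real n * ((a - 1) / a) * scalar_curv A g p
      - 4 * (real n)\<^sup>2 * (2 * real n + 1) * ((a - 1) / a)\<^sup>2
      - (2 * real n - 1)\<^sup>2 / (2 * real n + 1) * (laplacian A g f p)\<^sup>2
      - 2 * (2 * real n - 1)\<^sup>2 / (2 * real n + 1) * ((a - 1) / a)
          * (deriv_along \<xi> f p - deriv_along \<xi> (deriv_along \<xi> f) p) * laplacian A g f p
      + 2 * real n * (2 * real n - 1)\<^sup>2 / (2 * real n + 1) * ((a - 1) / a)\<^sup>2
          * (deriv_along \<xi> f p)\<^sup>2
      - 2 * (2 * real n - 1)\<^sup>2 * (real n + real n * a + a) * (a - 1) / ((2 * real n + 1) * a\<^sup>2)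
          * (deriv_along \<xi> (deriv_along \<xi> f) p)\<^sup>2
      + 2 * (2 * real n - 1)\<^sup>2 * (2 * real n + a) * (a - 1) / ((2 * real n + 1) * a\<^sup>2)
          * (deriv_along \<xi> f p * deriv_along \<xi> (deriv_along \<xi> f) p)"
proof -
  obtain D where D: "kenmotsu_manifold A \<phi> \<xi> \<eta> g D"
    using kenmotsu unfolding kenmotsu_def kenmotsu_manifold_def by blast
  then interpret deformed_kenmotsu A \<phi> \<xi> \<eta> g D a
    using a by (simp add: deformed_kenmotsu_def deformed_kenmotsu_axioms_def)
  have gb: "gb = deformed_kenmotsu.gb \<eta> g a"
    using deformed by (simp add: D_homothetic_def gb_def)
  interpret gradient_soliton A \<phi> \<xi> \<eta> g D a f lamb
    by unfold_locales (use f soliton V gb in auto)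
  show ?thesis by (rule ricci_norm_bound[OF dim n])
qed

end
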